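(* Let $\mathsf k$ be an infinite field and let $U$ be a Galois algebra over $\mathsf k$, that is, a $\mathsf k$-algebra which is a Galois $\Gamma$-ring in $\mathcal K=(L*\mathcal M)^G$. Then $U$ is a PI-algebra if and only if $\mathcal K$ is a PI-algebra. Moreover, $$T(U)=T(\mathcal K).$$
   Context: Setting: $\Lambda$ is an integrally closed (commutative) domain which is a $\mathsf k$-algebra, $G$ is a finite subgroup of the group $\operatorname{Aut}_{\mathsf k}(\Lambda)$ of $\mathsf k$-algebra automorphisms and $\mathcal M$ is a submonoid of $\operatorname{Aut}_{\mathsf k}(\Lambda)$ such that (1) $\mathcal M\mathcal M^{-1}\cap G=\{e\}$; (2) $G$ acts on $\mathcal M$ by conjugation, $g\cdot\mu=g\mu g^{-1}\in\mathcal M$; (3) $\Lambda$ is a Noetherian $\Lambda^G$-module. The monoid $\mathcal M$ is assumed finitely generated. Put $L=\operatorname{Frac}\Lambda$, $\Gamma=\Lambda^G$, $K=\operatorname{Frac}\Gamma=L^G$. The skew monoid ring $\mathcal L=L*\mathcal M$ is the free left $L$-module on $\mathcal M$ with multiplication $(a\mu)(b\nu)=a\,\mu(b)\,\mu\nu$. The group $G$ acts on $\mathcal L$ via $a\mu\mapsto g(a)\,(g\cdot\mu)$, and $\mathcal K=\mathcal L^G$ is the fixed ring. A Galois $\Gamma$-ring in $\mathcal K$ is a subring $U\subseteq\mathcal K$ containing $\Gamma$ and finitely generated as a ring over $\Gamma$ such that $KU=UK=\mathcal K$. A $\mathsf k$-algebra $A$ is a PI-algebra if there is a polynomial $f(x_1,\dots,x_n)$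 in the free associative unital algebra $\mathsf k\langle X\rangle$, $X=\{x_1,x_2,\dots\}$, having at least one monomial of maximal degree with coefficient $1$, such that $f(a_1,\dots,a_n)=0$ for all $a_i\in A$. The $T$-ideal $T(A)\subseteq\mathsf k\langle X\rangle$ is the ideal of all polynomials vanishing identically on $A$. *)

theory Defs
  imports
    "HOL-Library.Poly_Mapping"
    "HOL-Computational_Algebra.Polynomial_Factorial"
    "HOL-Algebra.Generated_Rings"
    "HOL-Algebra.Module"
begin

section \<open>Free associative algebra, polynomial identities\<close>

text \<open>
  A \<open>'k\<close>-algebra is a record \<open>A :: ('k, 'r, 'm) module_scheme\<close>: a possibly
  noncommutative unital ring together with a scalar multiplication by the field \<open>'k\<close>.
  The free associative unital algebra on \<open>x\<^sub>0, x\<^sub>1, \<dots>\<close> has the words in the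
  variables as a basis, the empty word being its unit.
\<close>

type_synonym 'k free_alg = "nat list \<Rightarrow>\<^sub>0 'k"

definition eval_word :: "('r, 'm) monoid_scheme \<Rightarrow> (nat \<Rightarrow> 'r) \<Rightarrow> nat list \<Rightarrow> 'r" where
  "eval_word A a w = foldr (\<lambda>i r. a i \<otimes>\<^bsub>A\<^esub> r) w \<one>\<^bsub>A\<^esub>"

definition eval_free ::
  "('k::zero, 'r, 'm) module_scheme \<Rightarrow> (nat \<Rightarrow> 'r) \<Rightarrow> 'k free_alg \<Rightarrow> 'r" where
  "eval_free A a f = (\<Oplus>\<^bsub>A\<^esub>w\<in>Poly_Mapping.keys f. Poly_Mapping.lookup f w \<odot>\<^bsub>A\<^esub> eval_word A a w)"

definition T_ideal :: "('k::zero, 'r, 'm) module_scheme \<Rightarrow> 'k free_alg set" where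
  "T_ideal A = {f. \<forall>a\<in>UNIV \<rightarrow> carrier A. eval_free A a f = \<zero>\<^bsub>A\<^esub>}"

definition PI_algebra :: "('k::zero_neq_one, 'r, 'm) module_scheme \<Rightarrow> bool" where
  "PI_algebra A \<longleftrightarrow>
    (\<exists>f\<in>T_ideal A. \<exists>w\<in>Poly_Mapping.keys f.
       Poly_Mapping.lookup f w = 1 \<and> (\<forall>v\<in>Poly_Mapping.keys f. length v \<le> length w))"


section \<open>Commutative algebra\<close>

definition integrally_closed :: "'a::idom itself \<Rightarrow> bool" where
  "integrally_closed _ \<longleftrightarrow>
    (\<forall>q :: 'a fract. (\<exists>p :: 'a poly. lead_coeff p = 1 \<and> poly (fract_poly p) q = 0)
       \<longrightarrow> q \<in> range to_fract)"

definition fixed_subring :: "('a \<Rightarrow> 'a) set \<Rightarrow> 'a set" where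
  "fixed_subring G = {x. \<forall>g\<in>G. g x = x}"

text \<open>Closure under negation is automatic when \<open>S\<close> is a subring, as \<open>-1 \<in> S\<close>.\<close>

definition is_submodule_over :: "'a::comm_ring_1 set \<Rightarrow> 'a set \<Rightarrow> bool" where
  "is_submodule_over S N \<longleftrightarrow>
    0 \<in> N \<and> (\<forall>x\<in>N. \<forall>y\<in>N. x + y \<in> N) \<and> (\<forall>s\<in>S. \<forall>x\<in>N. s * x \<in> N)"

text \<open>The ambient ring is a Noetherian module over its subring \<open>S\<close>.\<close>

definition noetherian_over :: "'a::comm_ring_1 set \<Rightarrow> bool" where
  "noetherian_over S \<longleftrightarrow>
    (\<forall>N. is_submodule_over S N \<longrightarrow>
      (\<exists>B. finite B \<and> B \<subseteq> N \<and> is_submodule_over S hull B = N))"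

definition alg_aut_group :: "('k::field \<Rightarrow> 'a::idom \<Rightarrow> 'a) \<Rightarrow> ('a \<Rightarrow> 'a) monoid" where
  "alg_aut_group scale =
    \<lparr>carrier = {f. bij f \<and> Vector_Spaces.linear scale scale f \<and>
                   (\<forall>x y. f (x * y) = f x * f y) \<and> f 1 = 1},
     mult = (\<circ>), one = id\<rparr>"

text \<open>The extension of an injective ring endomorphism to the field of fractions.\<close>

definition fract_map :: "('a::idom \<Rightarrow> 'a) \<Rightarrow> 'a fract \<Rightarrow> 'a fract" where
  "fract_map f q =
    (THE r. \<exists>a b. b \<noteq> 0 \<and> q = Fraction_Field.Fract a b \<and> r = Fraction_Field.Fract (f a) (f b))"

lemma fract_map_Fract:
  assumes mult: "\<And>x y. f (x * y) = f x * f y" and zero: "\<And>x. f x = 0 \<longleftrightarrow> x = 0"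
    and b: "b \<noteq> 0"
  shows "fract_map f (Fraction_Field.Fract a b) = Fraction_Field.Fract (f a) (f b)"
  unfolding fract_map_def
proof (rule the_equality)
  fix r assume "\<exists>c d. d \<noteq> 0 \<and> Fraction_Field.Fract a b = Fraction_Field.Fract c d \<and> r = Fraction_Field.Fract (f c) (f d)"
  then obtain c d where d: "d \<noteq> 0" "Fraction_Field.Fract a b = Fraction_Field.Fract c d" "r = Fraction_Field.Fract (f c) (f d)" by blast
  then have "a * d = c * b" using b by (simp add: eq_fract)
  then have "f a * f d = f c * f b" by (metis mult)
  then show "r = Fraction_Field.Fract (f a) (f b)" using d b zero by (simp add: eq_fract)
qed (use b in blast)


section \<open>Skew monoid rings\<close>

text \<open>
  With \<open>L = 'a fract\<close>, the element \<open>\<Sum> a\<^sub>\<mu> \<mu>\<close> of the skew monoid ring \<open>L * M\<close> is the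
  finitely supported function \<open>\<mu> \<mapsto> a\<^sub>\<mu>\<close> with support in \<open>M\<close>.
\<close>

type_synonym 'a skew = "('a \<Rightarrow> 'a) \<Rightarrow>\<^sub>0 'a fract"

definition skew_mult :: "'a::idom skew \<Rightarrow> 'a skew \<Rightarrow> 'a skew" where
  "skew_mult x y =
    (\<Sum>\<mu>\<in>Poly_Mapping.keys x. \<Sum>\<nu>\<in>Poly_Mapping.keys y.
       Poly_Mapping.single (\<mu> \<circ> \<nu>) (Poly_Mapping.lookup x \<mu> * fract_map \<mu> (Poly_Mapping.lookup y \<nu>)))"

definition skew_monoid_ring ::
  "('k::field \<Rightarrow> 'a::idom \<Rightarrow> 'a) \<Rightarrow> ('a \<Rightarrow> 'a) set \<Rightarrow> ('k, 'a skew) module" where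
  "skew_monoid_ring scale M =
    \<lparr>carrier = {x. Poly_Mapping.keys x \<subseteq> M},
     mult = skew_mult,
     one = Poly_Mapping.single id 1,
     zero = 0,
     add = (+),
     smult = (\<lambda>c. Poly_Mapping.map (\<lambda>q. to_fract (scale c 1) * q))\<rparr>"

definition skew_act ::
  "('k::field \<Rightarrow> 'a::idom \<Rightarrow> 'a) \<Rightarrow> ('a \<Rightarrow> 'a) \<Rightarrow> 'a skew \<Rightarrow> 'a skew" where
  "skew_act scale g x =
    (\<Sum>\<mu>\<in>Poly_Mapping.keys x.
       Poly_Mapping.single (g \<circ> \<mu> \<circ> inv\<^bsub>alg_aut_group scale\<^esub> g) (fract_map g (Poly_Mapping.lookup x \<mu>)))"

definition skew_fixed_ring ::
  "('k::field \<Rightarrow> 'a::idom \<Rightarrow> 'a) \<Rightarrow> ('a \<Rightarrow> 'a) set \<Rightarrow> ('a \<Rightarrow> 'a) set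
    \<Rightarrow> ('k, 'a skew) module" where
  "skew_fixed_ring scale G M =
    (skew_monoid_ring scale M)
      \<lparr>carrier := {x \<in> carrier (skew_monoid_ring scale M). \<forall>g\<in>G. skew_act scale g x = x}\<rparr>"


section \<open>Galois rings and Galois algebras\<close>

locale galois_setting = vector_space scale
  for scale :: "'k::field \<Rightarrow> 'a::idom \<Rightarrow> 'a" +
  fixes G M :: "('a \<Rightarrow> 'a) set"
  assumes scale_mult: "scale c (x * y) = scale c x * y"
    and closed: "integrally_closed TYPE('a)"
    and G_subgroup: "subgroup G (alg_aut_group scale)"
    and G_finite: "finite G"
    and M_submonoid: "submonoid M (alg_aut_group scale)"
    and M_separating:
      "(M <#>\<^bsub>alg_aut_group scale\<^esub> (set_inv\<^bsub>alg_aut_group scale\<^esub> M)) \<inter> G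
        = {\<one>\<^bsub>alg_aut_group scale\<^esub>}"
    and M_conj:
      "\<lbrakk>g \<in> G; \<mu> \<in> M\<rbrakk> \<Longrightarrow>
        g \<otimes>\<^bsub>alg_aut_group scale\<^esub> \<mu> \<otimes>\<^bsub>alg_aut_group scale\<^esub> inv\<^bsub>alg_aut_group scale\<^esub> g \<in> M"
    and M_fin_gen: "\<exists>S. finite S \<and> S \<subseteq> M \<and>
        (\<lambda>N. submonoid N (alg_aut_group scale)) hull S = M"
    and noetherian: "noetherian_over (fixed_subring G)"

text \<open>\<open>\<Gamma>\<close> and \<open>K = Frac \<Gamma>\<close>, embedded in the skew monoid ring by \<open>q \<mapsto> q \<cdot> id\<close>.\<close>

definition Gamma_in :: "('a::idom \<Rightarrow> 'a) set \<Rightarrow> 'a skew set" where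
  "Gamma_in G = (\<lambda>x. Poly_Mapping.single id (to_fract x)) ` fixed_subring G"

definition K_in :: "('a::idom \<Rightarrow> 'a) set \<Rightarrow> 'a skew set" where
  "K_in G = {Poly_Mapping.single id (Fraction_Field.Fract a b) | a b.
     a \<in> fixed_subring G \<and> b \<in> fixed_subring G \<and> b \<noteq> 0}"

text \<open>The product \<open>AB\<close> of additive subgroups: the additive span of all \<open>ab\<close>.\<close>

definition add_prod :: "('r, 'm) ring_scheme \<Rightarrow> 'r set \<Rightarrow> 'r set \<Rightarrow> 'r set" where
  "add_prod R A B = generate (add_monoid R) (A <#>\<^bsub>R\<^esub> B)"

definition galois_ring ::
  "('k::field \<Rightarrow> 'a::idom \<Rightarrow> 'a) \<Rightarrow> ('a \<Rightarrow> 'a) set \<Rightarrow> ('a \<Rightarrow> 'a) set \<Rightarrow> 'a skew set \<Rightarrow> bool"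
  where
  "galois_ring scale G M U \<longleftrightarrow>
    (let R = skew_fixed_ring scale G M in
      subring U R \<and> Gamma_in G \<subseteq> U \<and>
      (\<exists>S. finite S \<and> S \<subseteq> U \<and> U = generate_ring R (Gamma_in G \<union> S)) \<and>
      add_prod R (K_in G) U = carrier R \<and> add_prod R U (K_in G) = carrier R)"

text \<open>The \<open>'k\<close>-algebra structure on \<open>U\<close> is the restriction of the one on the fixed ring.\<close>

definition galois_algebra ::
  "('k::field \<Rightarrow> 'a::idom \<Rightarrow> 'a) \<Rightarrow> ('a \<Rightarrow> 'a) set \<Rightarrow> ('a \<Rightarrow> 'a) set \<Rightarrow> 'a skew set \<Rightarrow> bool"
  where
  "galois_algebra scale G M U \<longleftrightarrow>
    galois_ring scale G M U \<and>
    (\<forall>c. \<forall>u\<in>U. c \<odot>\<^bsub>skew_fixed_ring scale G M\<^esub> u \<in> U)"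

end

theory Submission
  imports Defs
begin

text \<open>
  \<open>\<K>\<close> acts faithfully on \<open>L\<close>, by Dedekind's independence of characters, so identities can be tested
  on operators. If \<open>M\<close> is finite, the norms \<open>\<Prod>\<^sub>\<mu> \<mu>(b)\<close> with \<open>b \<in> \<Gamma>\<close> are central in \<open>\<K>\<close>, so \<open>\<K> = KU\<close> is
  a central localization of \<open>U\<close>; homogeneity over the infinite field \<open>\<k>\<close> carries the identities of
  \<open>U\<close> over to \<open>\<K>\<close>. If \<open>M\<close> is infinite, \<open>U\<close> has no nonzero identity: linearize an identity of
  degree \<open>n\<close>, substitute \<open>y\<^sub>j = \<gamma>\<^sub>j u\<^sub>j \<delta>\<^sub>j\<close> with \<open>\<gamma>\<^sub>j, \<delta>\<^sub>j \<in> \<Gamma>\<close>, and expand. Every term is a walk in the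
  Cayley graph of \<open>M\<close>, weighted by a character of \<open>(\<gamma>, \<delta>)\<close> recording the two endpoints of each step.
  A walk with distinct vertices is determined by these data, so by independence of characters its
  coefficient vanishes. The elements of \<open>M\<close> are distinguished by their restrictions to \<open>\<Gamma>\<close>, as
  \<open>M M\<^sup>-\<^sup>1 \<inter> G = {id}\<close>.
\<close>

section \<open>Independence of characters\<close>

text \<open>Dedekind's elimination: evaluating the relation at a product with \<open>s0\<close> and
  subtracting \<open>chi l s0\<close> times the relation removes \<open>l\<close>, while the
  coefficient at \<open>k\<close> is multiplied by a nonzero factor. Only \<open>k\<close> has to be
  separated from the other characters, which may coincide among themselves; walks are treated in
  this form.\<close>

lemma dedekind_coefficient_zero:
  fixes chi :: "'i \<Rightarrow> 's \<Rightarrow> 'b::idom"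
  assumes "finite I" and "k \<in> I"
    and closed: "\<And>s t. s \<in> S \<Longrightarrow> t \<in> S \<Longrightarrow> m s t \<in> S"
    and mult: "\<And>i s t. i \<in> I \<Longrightarrow> s \<in> S \<Longrightarrow> t \<in> S \<Longrightarrow> chi i (m s t) = chi i s * chi i t"
    and e: "e \<in> S" "chi k e = 1"
    and sep: "\<And>i. i \<in> I \<Longrightarrow> i \<noteq> k \<Longrightarrow> \<exists>s\<in>S. chi i s \<noteq> chi k s"
    and rel: "\<And>s. s \<in> S \<Longrightarrow> (\<Sum>i\<in>I. c i * chi i s) = 0"
  shows "c k = 0"
  using assms
proof (induction "card I" arbitrary: I c rule: less_induct)
  case less
  show ?case
  proof (cases "I = {k}")
    case True
    then show ?thesis using less.prems(8)[OF e(1)] e(2) by simp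
  next
    case False
    then obtain l where l: "l \<in> I" "l \<noteq> k" using less.prems(2) by blast
    then obtain s0 where s0: "s0 \<in> S" "chi l s0 \<noteq> chi k s0" using less.prems(7) by blast
    define c' where "c' i = c i * (chi i s0 - chi l s0)" for i
    have "(\<Sum>i\<in>I - {l}. c' i * chi i s) = 0" if s: "s \<in> S" for s
    proof -
      have "(\<Sum>i\<in>I - {l}. c' i * chi i s) = (\<Sum>i\<in>I. c' i * chi i s)"
        using less.prems(1) l by (simp add: sum.remove c'_def)
      also have "\<dots> = (\<Sum>i\<in>I. c i * chi i (m s0 s)) - chi l s0 * (\<Sum>i\<in>I. c i * chi i s)"
        unfolding sum_distrib_left sum_subtractf[symmetric] c'_def
        using s s0(1) less.prems(4) by (intro sum.cong) (auto simp: algebra_simps)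
      also have "\<dots> = 0"
        using less.prems(8) s less.prems(3)[OF s0(1) s] by simp
      finally show ?thesis .
    qed
    moreover have "card (I - {l}) < card I"
      using less.prems(1) l(1) by (rule card_Diff1_less)
    ultimately have "c' k = 0"
      using less.prems l by (intro less.hyps[of "I - {l}" c']) auto
    then show ?thesis using s0 by (auto simp: c'_def)
  qed
qed

section \<open>Ring embeddings and fractions\<close>

text \<open>Injectivity keeps denominators nonzero, so that \<open>fract_map\<close> really is the
  extension to the field of fractions.\<close>

definition ring_embedding :: "('a::idom \<Rightarrow> 'a) \<Rightarrow> bool" where
  "ring_embedding f \<longleftrightarrow> inj f \<and> (\<forall>x y. f (x + y) = f x + f y) \<and> (\<forall>x y. f (x * y) = f x * f y) \<and> f 1 = 1"

lemma ring_embedding_simps: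
  assumes "ring_embedding f"
  shows "f (x + y) = f x + f y" "f (x * y) = f x * f y" "f 1 = 1" "f 0 = 0" "f x = 0 \<longleftrightarrow> x = 0"
    "f x = f y \<longleftrightarrow> x = y" "f (- x) = - f x"
proof -
  show *: "f (x + y) = f x + f y" "f (x * y) = f x * f y" "f 1 = 1" for x y
    using assms by (auto simp: ring_embedding_def)
  show **: "f x = f y \<longleftrightarrow> x = y" for x y
    using assms by (auto simp: ring_embedding_def inj_eq)
  show 0: "f 0 = 0" using *(1)[of 0 0] by (metis add_cancel_right_left add_0)
  show "f x = 0 \<longleftrightarrow> x = 0" using **[of x 0] 0 by simp
  have "f (- x) + f x = 0" using *(1)[of "-x" x] 0 by simp
  then show "f (- x) = - f x" by (simp add: add_eq_0_iff2)
qed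

lemma ring_embedding_sum: "ring_embedding f \<Longrightarrow> f (sum h A) = (\<Sum>i\<in>A. f (h i))"
  by (induction A rule: infinite_finite_induct) (auto simp: ring_embedding_simps)

lemma ring_embedding_prod: "ring_embedding f \<Longrightarrow> f (prod h A) = (\<Prod>i\<in>A. f (h i))"
  by (induction A rule: infinite_finite_induct) (auto simp: ring_embedding_simps)

lemma ring_embedding_comp: "ring_embedding f \<Longrightarrow> ring_embedding g \<Longrightarrow> ring_embedding (f \<circ> g)"
  by (auto simp: ring_embedding_def intro: inj_compose)

lemma ring_embedding_id: "ring_embedding id"
  by (auto simp: ring_embedding_def)

lemma fract_map_Fract':
  assumes "ring_embedding f" "b \<noteq> 0"
  shows "fract_map f (Fraction_Field.Fract a b) = Fraction_Field.Fract (f a) (f b)"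
  using assms by (intro fract_map_Fract) (auto simp: ring_embedding_simps)

lemma fract_map_simps:
  assumes f: "ring_embedding f"
  shows "fract_map f (to_fract a) = to_fract (f a)"
    "fract_map f (u + v) = fract_map f u + fract_map f v"
    "fract_map f (u * v) = fract_map f u * fract_map f v"
    "fract_map f 0 = 0" "fract_map f 1 = 1"
    "fract_map f u = 0 \<longleftrightarrow> u = 0"
proof -
  show tf: "fract_map f (to_fract a) = to_fract (f a)" for a
    using f by (simp add: to_fract_def fract_map_Fract' ring_embedding_simps)
  show "fract_map f 0 = 0" "fract_map f 1 = 1"
    using tf[of 0] tf[of 1] f by (simp_all add: ring_embedding_simps)
  obtain a b c d where u: "u = Fraction_Field.Fract a b" "b \<noteq> 0"
    and v: "v = Fraction_Field.Fract c d" "d \<noteq> 0"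
    by (metis Fract_cases)
  show "fract_map f (u + v) = fract_map f u + fract_map f v"
    "fract_map f (u * v) = fract_map f u * fract_map f v"
    using f u v by (simp_all add: fract_map_Fract' ring_embedding_simps)
  show "fract_map f u = 0 \<longleftrightarrow> u = 0"
    using f u by (simp add: fract_map_Fract' ring_embedding_simps Zero_fract_def eq_fract)
qed

lemma fract_map_sum: "ring_embedding f \<Longrightarrow> fract_map f (sum h A) = (\<Sum>i\<in>A. fract_map f (h i))"
  by (induction A rule: infinite_finite_induct) (auto simp: fract_map_simps)

lemma fract_map_comp:
  assumes "ring_embedding f" "ring_embedding g"
  shows "fract_map (f \<circ> g) u = fract_map f (fract_map g u)"
proof -
  obtain a b where u: "u = Fraction_Field.Fract a b" "b \<noteq> 0" by (metis Fract_cases)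
  then show ?thesis using assms
    by (simp add: fract_map_Fract' ring_embedding_simps ring_embedding_comp)
qed

lemma fract_map_id: "fract_map id u = u"
proof -
  obtain a b where u: "u = Fraction_Field.Fract a b" "b \<noteq> 0" by (metis Fract_cases)
  then show ?thesis by (simp add: fract_map_Fract' ring_embedding_id)
qed

section \<open>The action of the skew monoid ring on the field of fractions\<close>

definition skew_op :: "'a::idom skew \<Rightarrow> 'a fract \<Rightarrow> 'a fract" where
  "skew_op x v = (\<Sum>\<mu>\<in>Poly_Mapping.keys x. Poly_Mapping.lookup x \<mu> * fract_map \<mu> v)"

lemma skew_op_superset:
  assumes "finite S" "Poly_Mapping.keys x \<subseteq> S"
  shows "skew_op x v = (\<Sum>\<mu>\<in>S. Poly_Mapping.lookup x \<mu> * fract_map \<mu> v)"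
  unfolding skew_op_def using assms
  by (intro sum.mono_neutral_left) (auto simp: in_keys_iff)

lemma skew_op_0 [simp]: "skew_op 0 v = 0"
  by (simp add: skew_op_def)

lemma skew_op_add: "skew_op (x + y) v = skew_op x v + skew_op y v"
proof -
  let ?S = "Poly_Mapping.keys x \<union> Poly_Mapping.keys y"
  have "skew_op (x + y) v = (\<Sum>\<mu>\<in>?S. Poly_Mapping.lookup (x + y) \<mu> * fract_map \<mu> v)"
    by (rule skew_op_superset) (auto simp: Poly_Mapping.keys_add)
  also have "\<dots> = (\<Sum>\<mu>\<in>?S. Poly_Mapping.lookup x \<mu> * fract_map \<mu> v)
      + (\<Sum>\<mu>\<in>?S. Poly_Mapping.lookup y \<mu> * fract_map \<mu> v)"
    by (simp add: lookup_add algebra_simps sum.distrib)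
  also have "\<dots> = skew_op x v + skew_op y v"
    by (simp add: skew_op_superset[of ?S x] skew_op_superset[of ?S y])
  finally show ?thesis .
qed

lemma skew_op_uminus: "skew_op (- x) v = - skew_op x v"
  by (metis add_eq_0_iff2 neg_eq_iff_add_eq_0 skew_op_0 skew_op_add)

lemma skew_op_sum: "skew_op (sum h A) v = (\<Sum>i\<in>A. skew_op (h i) v)"
  by (induction A rule: infinite_finite_induct) (auto simp: skew_op_add)

lemma skew_op_single: "skew_op (Poly_Mapping.single \<mu> q) v = q * fract_map \<mu> v"
  by (simp add: skew_op_def)

lemma skew_op_scalar: "skew_op (Poly_Mapping.map (\<lambda>q. t * q) x) v = t * skew_op x v"
proof -
  have "skew_op (Poly_Mapping.map (\<lambda>q. t * q) x) v =
      (\<Sum>\<mu>\<in>Poly_Mapping.keys x. Poly_Mapping.lookup (Poly_Mapping.map (\<lambda>q. t * q) x) \<mu> * fract_map \<mu> v)"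
    by (rule skew_op_superset) (auto simp: in_keys_iff Poly_Mapping.map.rep_eq when_def)
  then show ?thesis
    by (auto simp: skew_op_def Poly_Mapping.map.rep_eq when_def sum_distrib_left mult.assoc in_keys_iff
      intro!: sum.cong)
qed

text \<open>The type \<open>'a skew\<close> admits arbitrary maps in the support, whereas the laws
  of \<open>fract_map\<close> are available for embeddings.\<close>

abbreviation embedding_supported :: "'a::idom skew \<Rightarrow> bool" where
  "embedding_supported x \<equiv> \<forall>\<mu>\<in>Poly_Mapping.keys x. ring_embedding \<mu>"

lemma skew_op_arg:
  assumes "embedding_supported x"
  shows "skew_op x 0 = 0" "skew_op x (u + v) = skew_op x u + skew_op x v"
    "skew_op x (sum h A) = (\<Sum>i\<in>A. skew_op x (h i))"
proof -
  show 0: "skew_op x 0 = 0" "skew_op x (u + v) = skew_op x u + skew_op x v" for u v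
    using assms by (auto simp: skew_op_def fract_map_simps algebra_simps sum.distrib intro!: sum.neutral)
  show "skew_op x (sum h A) = (\<Sum>i\<in>A. skew_op x (h i))"
    by (induction A rule: infinite_finite_induct) (auto simp: 0)
qed

lemma skew_op_mult:
  assumes "embedding_supported x" "embedding_supported y"
  shows "skew_op (skew_mult x y) v = skew_op x (skew_op y v)"
proof -
  have "skew_op (skew_mult x y) v =
      (\<Sum>\<mu>\<in>Poly_Mapping.keys x. \<Sum>\<nu>\<in>Poly_Mapping.keys y. Poly_Mapping.lookup x \<mu> *
         fract_map \<mu> (Poly_Mapping.lookup y \<nu>) * fract_map \<mu> (fract_map \<nu> v))"
    using assms by (auto simp: skew_mult_def skew_op_sum skew_op_single fract_map_comp intro!: sum.cong)
  also have "\<dots> = skew_op x (skew_op y v)"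
    using assms by (auto simp: skew_op_def fract_map_sum fract_map_simps sum_distrib_left mult.assoc intro!: sum.cong)
  finally show ?thesis .
qed

lemma keys_skew_mult:
  "Poly_Mapping.keys (skew_mult x y) \<subseteq> {\<mu> \<circ> \<nu> | \<mu> \<nu>. \<mu> \<in> Poly_Mapping.keys x \<and> \<nu> \<in> Poly_Mapping.keys y}"
  unfolding skew_mult_def
  by (fastforce dest!: Poly_Mapping.keys_sum[THEN subsetD] split: if_splits)

text \<open>Faithfulness of the action: on elements of the domain the operator is a linear
  combination of the maps in the support, which are distinct multiplicative characters.\<close>

lemma skew_op_eq_0D:
  assumes x: "embedding_supported x" and 0: "\<And>v. skew_op x v = 0"
  shows "x = 0"
proof (rule poly_mapping_eqI)
  fix \<mu> show "Poly_Mapping.lookup x \<mu> = Poly_Mapping.lookup 0 \<mu>"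
  proof (cases "\<mu> \<in> Poly_Mapping.keys x")
    case True
    have "Poly_Mapping.lookup x \<mu> = 0"
    proof (rule dedekind_coefficient_zero[of "Poly_Mapping.keys x" \<mu> UNIV "(*)"
          "\<lambda>\<nu> a. to_fract (\<nu> a)" 1])
      show "\<exists>s\<in>UNIV. to_fract (\<nu> s) \<noteq> to_fract (\<mu> s)" if "\<nu> \<noteq> \<mu>" for \<nu>
        using that by auto
      show "(\<Sum>\<nu>\<in>Poly_Mapping.keys x. Poly_Mapping.lookup x \<nu> * to_fract (\<nu> s)) = 0" for s
        using 0[of "to_fract s"] x by (simp add: skew_op_def fract_map_simps)
    qed (use True x in \<open>auto simp: ring_embedding_simps\<close>)
    then show ?thesis by simp
  qed (simp add: in_keys_iff)
qed

lemma skew_op_inject: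
  assumes "embedding_supported x" "embedding_supported y" and "\<And>v. skew_op x v = skew_op y v"
  shows "x = y"
proof -
  have "Poly_Mapping.keys (x - y) \<subseteq> Poly_Mapping.keys x \<union> Poly_Mapping.keys y"
    by (rule Poly_Mapping.keys_diff)
  then have "x - y = 0"
    using assms skew_op_add[of x "- y"] by (intro skew_op_eq_0D) (auto simp: skew_op_uminus)
  then show ?thesis by simp
qed

section \<open>Automorphisms of the domain and the invariant ring \<Gamma>\<close>

context galois_setting
begin

abbreviation "Aut \<equiv> alg_aut_group scale"
abbreviation "Kring \<equiv> skew_fixed_ring scale G M"
abbreviation "\<Gamma> \<equiv> fixed_subring G"

lemma mem_Aut_iff:
  "f \<in> carrier Aut \<longleftrightarrow> bij f \<and> ring_embedding f \<and> (\<forall>c x. f (scale c x) = scale c (f x))"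
  by (auto simp: alg_aut_group_def Vector_Spaces.linear_iff ring_embedding_def vector_space_axioms bij_is_inj)

lemma mult_Aut [simp]: "f \<otimes>\<^bsub>Aut\<^esub> g = f \<circ> g"
  by (simp add: alg_aut_group_def)

lemma one_Aut [simp]: "\<one>\<^bsub>Aut\<^esub> = id"
  by (simp add: alg_aut_group_def)

lemma inv_into_Aut:
  assumes "f \<in> carrier Aut"
  shows "inv_into UNIV f \<in> carrier Aut"
proof -
  let ?h = "inv_into UNIV f"
  have f: "bij f" "ring_embedding f" "\<And>c x. f (scale c x) = scale c (f x)"
    using assms by (auto simp: mem_Aut_iff)
  have h: "f (?h x) = x" for x using f(1) by (simp add: bij_is_surj surj_f_inv_f)
  have "?h (x + y) = ?h x + ?h y" "?h (x * y) = ?h x * ?h y" "?h 1 = 1"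
    "?h (scale c x) = scale c (?h x)" for x y c
    by (rule injD[OF bij_is_inj[OF f(1)]]; simp add: h f ring_embedding_simps[OF f(2)])+
  then show ?thesis
    using bij_imp_bij_inv[OF f(1)] by (auto simp: mem_Aut_iff ring_embedding_def bij_is_inj)
qed

lemma group_Aut: "group Aut"
proof (rule groupI)
  show "\<exists>y\<in>carrier Aut. y \<otimes>\<^bsub>Aut\<^esub> x = \<one>\<^bsub>Aut\<^esub>" if "x \<in> carrier Aut" for x
    using inv_into_Aut[OF that] that by (auto simp: mem_Aut_iff bij_is_inj intro!: bexI[of _ "inv_into UNIV x"])
qed (auto simp: mem_Aut_iff bij_comp ring_embedding_comp ring_embedding_id)

lemma m_inv_Aut: "f \<in> carrier Aut \<Longrightarrow> inv\<^bsub>Aut\<^esub> f = inv_into UNIV f"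
  by (rule group.inv_equality[OF group_Aut]) (auto simp: inv_into_Aut, auto simp: mem_Aut_iff bij_is_inj)

lemma G_Aut: "g \<in> G \<Longrightarrow> g \<in> carrier Aut"
  using subgroup.subset[OF G_subgroup] by auto

lemma M_Aut: "\<mu> \<in> M \<Longrightarrow> \<mu> \<in> carrier Aut"
  using submonoid.subset[OF M_submonoid] by auto

lemma G_embedding: "g \<in> G \<Longrightarrow> ring_embedding g"
  and M_embedding: "\<mu> \<in> M \<Longrightarrow> ring_embedding \<mu>"
  using G_Aut M_Aut by (auto simp: mem_Aut_iff)

lemma M_id: "id \<in> M" and M_comp: "\<mu> \<in> M \<Longrightarrow> \<nu> \<in> M \<Longrightarrow> \<mu> \<circ> \<nu> \<in> M"
  using submonoid.one_closed[OF M_submonoid] submonoid.m_closed[OF M_submonoid] by auto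

lemma G_id: "id \<in> G" and G_comp: "g \<in> G \<Longrightarrow> h \<in> G \<Longrightarrow> g \<circ> h \<in> G"
  and G_inv: "g \<in> G \<Longrightarrow> inv_into UNIV g \<in> G"
  using subgroup.one_closed[OF G_subgroup] subgroup.m_closed[OF G_subgroup]
    subgroup.m_inv_closed[OF G_subgroup] m_inv_Aut[OF G_Aut] by auto

lemma M_conj': "g \<in> G \<Longrightarrow> \<mu> \<in> M \<Longrightarrow> g \<circ> \<mu> \<circ> inv_into UNIV g \<in> M"
  using M_conj m_inv_Aut[OF G_Aut] by simp

lemma Aut_inv_simps:
  assumes "f \<in> carrier Aut"
  shows "f (inv_into UNIV f x) = x" "inv_into UNIV f (f x) = x"
    "f \<circ> inv_into UNIV f = id" "inv_into UNIV f \<circ> f = id"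
  using assms by (auto simp: mem_Aut_iff bij_is_inj bij_is_surj surj_f_inv_f fun_eq_iff)

lemma G_translate:
  assumes "g \<in> G"
  shows "bij_betw (\<lambda>h. g \<circ> h) G G"
proof (rule bij_betw_byWitness[where f' = "\<lambda>h. inv_into UNIV g \<circ> h"])
qed (auto simp: G_comp G_inv assms comp_assoc[symmetric] Aut_inv_simps[OF G_Aut[OF assms]])

lemma M_conj_bij:
  assumes "g \<in> G"
  shows "bij_betw (\<lambda>\<mu>. g \<circ> \<mu> \<circ> inv_into UNIV g) M M"
proof (rule bij_betw_byWitness[where f' = "\<lambda>\<mu>. inv_into UNIV g \<circ> \<mu> \<circ> g"])
  have g: "g \<in> carrier Aut" by (rule G_Aut[OF assms])
  show "\<forall>a\<in>M. inv_into UNIV g \<circ> (g \<circ> a \<circ> inv_into UNIV g) \<circ> g = a"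
    "\<forall>a\<in>M. g \<circ> (inv_into UNIV g \<circ> a \<circ> g) \<circ> inv_into UNIV g = a"
    by (auto simp: fun_eq_iff Aut_inv_simps[OF g])
  show "(\<lambda>\<mu>. g \<circ> \<mu> \<circ> inv_into UNIV g) ` M \<subseteq> M"
    using M_conj' assms by auto
  have "inv_into UNIV (inv_into UNIV g) = g"
    using g by (simp add: mem_Aut_iff inv_inv_eq)
  then show "(\<lambda>\<mu>. inv_into UNIV g \<circ> \<mu> \<circ> g) ` M \<subseteq> M"
    using M_conj'[OF G_inv[OF assms]] by auto
qed

lemma fixed_subring_closed:
  "x \<in> \<Gamma> \<Longrightarrow> y \<in> \<Gamma> \<Longrightarrow> x * y \<in> \<Gamma>" "x \<in> \<Gamma> \<Longrightarrow> scale c x \<in> \<Gamma>" "1 \<in> \<Gamma>" "0 \<in> \<Gamma>" "x \<in> \<Gamma> \<Longrightarrow> - x \<in> \<Gamma>"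
proof -
  show "scale c x \<in> \<Gamma>" if "x \<in> \<Gamma>"
  proof -
    have "g (scale c x) = scale c x" if g: "g \<in> G" for g
    proof -
      have "g (scale c x) = scale c (g x)" using G_Aut[OF g] by (simp add: mem_Aut_iff)
      then show ?thesis using \<open>x \<in> \<Gamma>\<close> g by (simp add: fixed_subring_def)
    qed
    then show ?thesis by (simp add: fixed_subring_def)
  qed
qed (use G_embedding in \<open>auto simp: fixed_subring_def ring_embedding_simps\<close>)

text \<open>
  If \<open>\<mu>\<close> and \<open>\<nu>\<close> agree on \<open>\<Gamma>\<close>, comparing their values on traces gives a relation
  between the characters \<open>\<mu>g\<close> and \<open>\<nu>g\<close>, so \<open>\<mu> = \<nu>g\<close> for some \<open>g \<in> G\<close>.
\<close>

lemma separating: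
  assumes \<mu>: "\<mu> \<in> M" and \<nu>: "\<nu> \<in> M" and eq: "\<And>x. x \<in> \<Gamma> \<Longrightarrow> \<mu> x = \<nu> x"
  shows "\<mu> = \<nu>"
proof -
  have "\<exists>g\<in>G. \<mu> = \<nu> \<circ> g"
  proof (rule ccontr)
    assume no: "\<not> (\<exists>g\<in>G. \<mu> = \<nu> \<circ> g)"
    \<comment> \<open>\<open>Inl\<close> indexes the maps \<mu>g with coefficient 1 and
      \<open>Inr\<close> the maps \<nu>g with coefficient -1, so that equality of \<mu> and \<nu> on
      traces becomes one linear relation.\<close>
    define chi :: "('a \<Rightarrow> 'a) + ('a \<Rightarrow> 'a) \<Rightarrow> 'a \<Rightarrow> 'a" where "chi = case_sum (\<lambda>g. \<mu> \<circ> g) (\<lambda>g. \<nu> \<circ> g)"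
    define c :: "(('a \<Rightarrow> 'a) + ('a \<Rightarrow> 'a)) \<Rightarrow> 'a" where "c = case_sum (\<lambda>g. 1) (\<lambda>g. - 1)"
    have emb: "ring_embedding (chi i)" if "i \<in> G <+> G" for i
      using that \<mu> \<nu> by (auto simp: chi_def ring_embedding_comp[OF M_embedding G_embedding])
    have "Inl id \<in> G <+> G" using G_id by blast
    note chi1 = ring_embedding_simps(3)[OF emb[OF this]]
    have "c (Inl id) = 0"
    proof (rule dedekind_coefficient_zero[of "G <+> G" "Inl id" UNIV "(*)" chi 1])
      \<comment> \<open>Only \<mu> itself must be separated: \<mu>g = \<mu> forces g = id by
        injectivity, and \<nu>g = \<mu> is excluded by assumption.\<close>
      show "\<exists>s\<in>UNIV. chi i s \<noteq> chi (Inl id) s" if i: "i \<in> G <+> G" "i \<noteq> Inl id" for i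
      proof (rule ccontr)
        assume "\<not> ?thesis"
        then have e: "chi i = \<mu>" by (auto simp: chi_def)
        then obtain g where g: "i = Inl g" "g \<in> G" using i no by (auto simp: chi_def)
        then have "\<mu> (g x) = \<mu> x" for x using e by (auto simp: chi_def fun_eq_iff)
        then have "g = id" using M_embedding[OF \<mu>] by (auto simp: ring_embedding_simps)
        then show False using i g by simp
      qed
      show "(\<Sum>i\<in>G <+> G. c i * chi i s) = 0" for s
      proof -
        have "(\<Sum>g\<in>G. g s) \<in> \<Gamma>"
          unfolding fixed_subring_def
        proof (clarify)
          fix h assume h: "h \<in> G"
          have "h (\<Sum>g\<in>G. g s) = (\<Sum>g\<in>G. (h \<circ> g) s)"
            by (simp add: ring_embedding_sum G_embedding h)
          also have "\<dots> = (\<Sum>g\<in>G. g s)"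
            by (rule sum.reindex_bij_betw[OF G_translate[OF h], where g = "\<lambda>g. g s"])
          finally show "h (\<Sum>g\<in>G. g s) = (\<Sum>g\<in>G. g s)" .
        qed
        then have "\<mu> (\<Sum>g\<in>G. g s) = \<nu> (\<Sum>g\<in>G. g s)" by (rule eq)
        then show ?thesis
          using G_finite M_embedding[OF \<mu>] M_embedding[OF \<nu>]
          by (simp add: sum.Plus c_def chi_def ring_embedding_sum sum_negf)
      qed
    qed (use G_finite G_id emb chi1 in \<open>auto simp: ring_embedding_simps\<close>)
    then show False by (simp add: c_def)
  qed
  then obtain g where g: "g \<in> G" "\<mu> = \<nu> \<circ> g" by blast
  \<comment> \<open>Since \<mu> = \<nu>g, conjugating \<mu> by g gives g\<nu>. Hence g =
    (g\<nu>)\<nu>\<open>\<^sup>-\<^sup>1\<close> is a quotient of two elements of M that lies in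
    G.\<close>
  have "g \<circ> \<nu> = g \<circ> \<mu> \<circ> inv_into UNIV g"
    using g by (simp add: comp_assoc Aut_inv_simps[OF G_Aut])
  then have g\<nu>: "g \<circ> \<nu> \<in> M" using M_conj'[OF g(1) \<mu>] by simp
  have "g = (g \<circ> \<nu>) \<otimes>\<^bsub>Aut\<^esub> inv\<^bsub>Aut\<^esub> \<nu>"
    using \<nu> by (simp add: m_inv_Aut M_Aut comp_assoc Aut_inv_simps[OF M_Aut])
  then have "g \<in> M <#>\<^bsub>Aut\<^esub> (set_inv\<^bsub>Aut\<^esub> M)"
    using g\<nu> \<nu> unfolding set_mult_def SET_INV_def by blast
  then have "g = id" using M_separating g(1) by auto
  then show ?thesis using g by simp
qed

section \<open>The fixed ring as a ring of operators\<close>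

lemma M_supported:
  "Poly_Mapping.keys x \<subseteq> M \<Longrightarrow> embedding_supported x"
  using M_embedding by auto

lemma Kring_ops [simp]:
  "mult Kring = skew_mult" "one Kring = Poly_Mapping.single id 1" "zero Kring = 0" "add Kring = (+)"
  "smult Kring = (\<lambda>c. Poly_Mapping.map (\<lambda>q. to_fract (scale c 1) * q))"
  by (simp_all add: skew_fixed_ring_def skew_monoid_ring_def)

lemma skew_op_act:
  assumes "g \<in> G" "Poly_Mapping.keys x \<subseteq> M"
  shows "skew_op (skew_act scale g x) v = fract_map g (skew_op x (fract_map (inv_into UNIV g) v))"
proof -
  have "fract_map (g \<circ> \<mu> \<circ> inv_into UNIV g) v = fract_map g (fract_map \<mu> (fract_map (inv_into UNIV g) v))"
    if "\<mu> \<in> Poly_Mapping.keys x" for \<mu>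
    using that assms by (subst fract_map_comp fract_map_comp; auto intro: ring_embedding_comp G_embedding M_embedding G_inv)+
  then show ?thesis
    using assms M_embedding
    by (auto simp: skew_act_def skew_op_sum skew_op_single m_inv_Aut G_Aut skew_op_def[of x]
        fract_map_sum fract_map_simps G_embedding intro!: sum.cong)
qed

lemma keys_skew_act:
  assumes "g \<in> G" "Poly_Mapping.keys x \<subseteq> M"
  shows "Poly_Mapping.keys (skew_act scale g x) \<subseteq> M"
  using assms unfolding skew_act_def
  by (fastforce dest!: Poly_Mapping.keys_sum[THEN subsetD] simp: m_inv_Aut G_Aut M_conj' split: if_splits)

text \<open>Acting by g on a skew element conjugates its operator by g. By faithfulness, being fixed
  therefore means that the operator commutes with G, which makes the closure properties
  immediate.\<close>

lemma mem_Kring_iff: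
  "x \<in> carrier Kring \<longleftrightarrow>
    Poly_Mapping.keys x \<subseteq> M \<and> (\<forall>g\<in>G. \<forall>v. skew_op x (fract_map g v) = fract_map g (skew_op x v))"
proof -
  have "skew_act scale g x = x \<longleftrightarrow> (\<forall>v. skew_op x (fract_map g v) = fract_map g (skew_op x v))"
    if g: "g \<in> G" and x: "Poly_Mapping.keys x \<subseteq> M" for g
  proof -
    have inv: "fract_map (inv_into UNIV g) (fract_map g v) = v"
      "fract_map g (fract_map (inv_into UNIV g) v) = v" for v
      using g by (simp_all add: fract_map_comp[symmetric] G_embedding G_inv Aut_inv_simps[OF G_Aut] fract_map_id)
    have "skew_act scale g x = x \<longleftrightarrow> (\<forall>v. skew_op (skew_act scale g x) v = skew_op x v)"
      using skew_op_inject[of "skew_act scale g x" x] M_supported keys_skew_act[OF g x] x by auto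
    also have "\<dots> \<longleftrightarrow> (\<forall>v. fract_map g (skew_op x (fract_map (inv_into UNIV g) v)) = skew_op x v)"
      by (simp add: skew_op_act[OF g x])
    also have "\<dots> \<longleftrightarrow> (\<forall>v. skew_op x (fract_map g v) = fract_map g (skew_op x v))"
      by (metis inv)
    finally show ?thesis .
  qed
  then show ?thesis
    by (auto simp: skew_fixed_ring_def skew_monoid_ring_def)
qed

lemma Kring_supported: "x \<in> carrier Kring \<Longrightarrow> embedding_supported x"
  using M_supported mem_Kring_iff by blast

lemma Kring_eqI:
  "x \<in> carrier Kring \<Longrightarrow> y \<in> carrier Kring \<Longrightarrow> (\<And>v. skew_op x v = skew_op y v) \<Longrightarrow> x = y"
  by (intro skew_op_inject Kring_supported)

lemma Kring_mult_op:
  "x \<in> carrier Kring \<Longrightarrow> y \<in> carrier Kring \<Longrightarrow> skew_op (skew_mult x y) v = skew_op x (skew_op y v)"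
  by (intro skew_op_mult Kring_supported)

lemma Kring_closed:
  assumes "x \<in> carrier Kring" "y \<in> carrier Kring"
  shows "x + y \<in> carrier Kring" "- x \<in> carrier Kring" "skew_mult x y \<in> carrier Kring"
    "0 \<in> carrier Kring" "Poly_Mapping.map (\<lambda>q. to_fract (scale c 1) * q) x \<in> carrier Kring"
proof -
  have xy: "Poly_Mapping.keys x \<subseteq> M" "Poly_Mapping.keys y \<subseteq> M"
    "\<And>g v. g \<in> G \<Longrightarrow> skew_op x (fract_map g v) = fract_map g (skew_op x v)"
    "\<And>g v. g \<in> G \<Longrightarrow> skew_op y (fract_map g v) = fract_map g (skew_op y v)"
    using assms by (auto simp: mem_Kring_iff)
  have fm_uminus: "fract_map g (- u) = - fract_map g u" if "g \<in> G" for g u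
    using that fract_map_simps(2)[of g u "- u"] fract_map_simps(4)[of g] G_embedding
    by (metis add.right_inverse add_eq_0_iff)
  show "0 \<in> carrier Kring"
    by (auto simp: mem_Kring_iff fract_map_simps G_embedding)
  show "x + y \<in> carrier Kring"
    using xy Poly_Mapping.keys_add[of x y] by (auto simp: mem_Kring_iff fract_map_simps G_embedding skew_op_add)
  show "- x \<in> carrier Kring"
    using xy by (auto simp: mem_Kring_iff skew_op_uminus fm_uminus)
  show "skew_mult x y \<in> carrier Kring"
    using xy keys_skew_mult[of x y] M_comp
    by (simp add: mem_Kring_iff Kring_mult_op[OF assms]) blast
  \<comment> \<open>Scalars are G-invariant, since \<open>scale c 1\<close> lies in \<Gamma> along
    with 1.\<close>
  have c: "fract_map g (to_fract (scale c 1) * u) = to_fract (scale c 1) * fract_map g u" if "g \<in> G" for g u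
    using fixed_subring_closed(2)[OF fixed_subring_closed(3), of c] that
    by (simp add: fixed_subring_def fract_map_simps[OF G_embedding])
  have "Poly_Mapping.keys (Poly_Mapping.map (\<lambda>q. to_fract (scale c 1) * q) x) \<subseteq> Poly_Mapping.keys x"
    by (auto simp: in_keys_iff Poly_Mapping.map.rep_eq when_def)
  then show "Poly_Mapping.map (\<lambda>q. to_fract (scale c 1) * q) x \<in> carrier Kring"
    using xy c by (auto simp: mem_Kring_iff skew_op_scalar)
qed

end

section \<open>The Galois algebra U and its identities\<close>

locale galois_algebra_setting = galois_setting scale G M
  for scale :: "'k::field \<Rightarrow> 'a::idom \<Rightarrow> 'a" and G M :: "('a \<Rightarrow> 'a) set" +
  fixes U :: "'a skew set"
  assumes U: "galois_algebra scale G M U"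
    and infinite_scalars: "infinite (UNIV :: 'k set)"
begin

lemma Kring_scalar: "x \<in> \<Gamma> \<Longrightarrow> Poly_Mapping.single id (to_fract x) \<in> carrier Kring"
  by (auto simp: mem_Kring_iff M_id skew_op_single fract_map_id fixed_subring_def
     fract_map_simps[OF G_embedding])

lemma U_subring: "subring U Kring"
  using U by (simp add: galois_algebra_def galois_ring_def Let_def)

lemma U_Kring: "x \<in> U \<Longrightarrow> x \<in> carrier Kring"
  using subring.axioms(1)[OF U_subring] subgroup.subset by fastforce

lemma U_closed:
  "x \<in> U \<Longrightarrow> y \<in> U \<Longrightarrow> x + y \<in> U" "x \<in> U \<Longrightarrow> y \<in> U \<Longrightarrow> skew_mult x y \<in> U"
  "0 \<in> U" "Poly_Mapping.single id 1 \<in> U"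
  "x \<in> U \<Longrightarrow> Poly_Mapping.map (\<lambda>q. to_fract (scale c 1) * q) x \<in> U"
  using subgroup.m_closed[OF subring.axioms(1)[OF U_subring]]
    subgroup.one_closed[OF subring.axioms(1)[OF U_subring]]
    submonoid.m_closed[OF subring.axioms(2)[OF U_subring]]
    submonoid.one_closed[OF subring.axioms(2)[OF U_subring]]
    U by (auto simp: galois_algebra_def)

lemma U_scalar: "x \<in> \<Gamma> \<Longrightarrow> Poly_Mapping.single id (to_fract x) \<in> U"
  using U by (auto simp: galois_algebra_def galois_ring_def Let_def Gamma_in_def)

lemma op_scalar: "skew_op (Poly_Mapping.single id q) v = q * v"
  by (simp add: skew_op_single fract_map_id)

lemma U_sum: "(\<And>i. i \<in> A \<Longrightarrow> h i \<in> U) \<Longrightarrow> sum h A \<in> U"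
  by (induction A rule: infinite_finite_induct) (auto simp: U_closed)

lemma Kring_eq: "carrier Kring = generate (add_monoid Kring) (K_in G <#>\<^bsub>Kring\<^esub> U)"
  using U by (simp add: galois_algebra_def galois_ring_def Let_def add_prod_def)

text \<open>The hypothesis that KU is the whole fixed ring, turned into an induction rule:
  everything arises from products (a/b)u by sums and negation.\<close>

lemma Kring_induct [consumes 1, case_names zero incl minus add]:
  assumes "y \<in> carrier Kring"
    and zero: "P 0"
    and incl: "\<And>a b u. a \<in> \<Gamma> \<Longrightarrow> b \<in> \<Gamma> \<Longrightarrow> b \<noteq> 0 \<Longrightarrow> u \<in> U \<Longrightarrow>
      P (skew_mult (Poly_Mapping.single id (Fraction_Field.Fract a b)) u)"
    and minus: "\<And>y. y \<in> carrier Kring \<Longrightarrow> P y \<Longrightarrow> P (- y)"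
    and add: "\<And>x y. x \<in> carrier Kring \<Longrightarrow> y \<in> carrier Kring \<Longrightarrow> P x \<Longrightarrow> P y \<Longrightarrow> P (x + y)"
  shows "P y"
proof -
  have base: "P h" "h \<in> carrier Kring" if h: "h \<in> K_in G <#>\<^bsub>Kring\<^esub> U" for h
  proof -
    show "P h" using h incl by (auto simp: set_mult_def K_in_def)
    show "h \<in> carrier Kring" by (subst Kring_eq) (rule generate.incl[OF h])
  qed
  have "P y \<and> y \<in> carrier Kring" if "y \<in> generate (add_monoid Kring) (K_in G <#>\<^bsub>Kring\<^esub> U)"
    using that
  proof induction
    case (inv h)
    note h = base[OF inv]
    have "inv\<^bsub>add_monoid Kring\<^esub> h = - h"
      unfolding m_inv_def using h(2) Kring_closed[OF h(2) h(2)]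
      by (intro the_equality) (auto simp: eq_neg_iff_add_eq_0 add.commute)
    then show ?case using minus h Kring_closed(2) by simp
  next
    case (eng h1 h2)
    then show ?case using add Kring_closed(1) by simp
  qed (use zero base U_Kring[OF U_closed(3)] in auto)
  then show ?thesis using assms(1) by (subst (asm) Kring_eq) blast
qed

text \<open>A word acts as the composition of the operators of its letters, and by faithfulness an
  evaluation is zero exactly when its operator is. The set \<open>C\<close> is left open so that
  both U and the whole fixed ring are covered.\<close>

lemma mem_T_ideal_iff:
  assumes sub: "C \<subseteq> carrier Kring"
    and C: "0 \<in> C" "Poly_Mapping.single id 1 \<in> C" "\<And>x y. x \<in> C \<Longrightarrow> y \<in> C \<Longrightarrow> x + y \<in> C"
      "\<And>x y. x \<in> C \<Longrightarrow> y \<in> C \<Longrightarrow> skew_mult x y \<in> C"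
      "\<And>c x. x \<in> C \<Longrightarrow> Poly_Mapping.map (\<lambda>q. to_fract (scale c 1) * q) x \<in> C"
  shows "f \<in> T_ideal (Kring\<lparr>carrier := C\<rparr>) \<longleftrightarrow>
    (\<forall>a\<in>UNIV \<rightarrow> C. \<forall>v. (\<Sum>w\<in>Poly_Mapping.keys f. to_fract (scale (Poly_Mapping.lookup f w) 1) *
       foldr (\<lambda>i. skew_op (a i)) w v) = 0)"
proof -
  let ?R = "Kring\<lparr>carrier := C\<rparr>"
  have R: "abelian_monoid ?R"
    by (rule abelian_monoidI) (auto simp: C add.assoc add.commute)
  have finsum: "finsum ?R h A = sum h A \<and> sum h A \<in> C" if "h \<in> A \<rightarrow> C" "finite A"
    for h :: "nat list \<Rightarrow> 'a skew" and A
    using that(2,1)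
  proof induction
    case empty
    then show ?case using abelian_monoid.finsum_empty[OF R] C by simp
  next
    case (insert x F)
    then show ?case using abelian_monoid.finsum_insert[OF R, of F x h] C by simp
  qed
  have "eval_free ?R a f = 0 \<longleftrightarrow> (\<forall>v. (\<Sum>w\<in>Poly_Mapping.keys f.
    to_fract (scale (Poly_Mapping.lookup f w) 1) * foldr (\<lambda>i. skew_op (a i)) w v) = 0)"
    if a: "a \<in> UNIV \<rightarrow> C" for a
  proof -
    have word: "eval_word ?R a w \<in> C \<and> skew_op (eval_word ?R a w) v = foldr (\<lambda>i. skew_op (a i)) w v"
      for w v
    proof (induction w)
      case Nil
      then show ?case by (simp add: eval_word_def C op_scalar)
    next
      case (Cons i w)
      have "a i \<in> C" using a by auto
      moreover from this have "skew_op (skew_mult (a i) (eval_word ?R a w)) v = skew_op (a i) (skew_op (eval_word ?R a w) v)"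
        using Cons sub by (intro Kring_mult_op) auto
      ultimately show ?case using Cons C by (simp add: eval_word_def)
    qed
    let ?h = "\<lambda>w. Poly_Mapping.lookup f w \<odot>\<^bsub>?R\<^esub> eval_word ?R a w"
    have h: "?h \<in> Poly_Mapping.keys f \<rightarrow> C" using word C(5) by auto
    have e: "eval_free ?R a f = sum ?h (Poly_Mapping.keys f)" "eval_free ?R a f \<in> C"
      unfolding eval_free_def using finsum[OF h] by auto
    have op: "skew_op (eval_free ?R a f) v = (\<Sum>w\<in>Poly_Mapping.keys f.
      to_fract (scale (Poly_Mapping.lookup f w) 1) * foldr (\<lambda>i. skew_op (a i)) w v)" for v
      unfolding e(1) skew_op_sum using word by (auto simp: skew_op_scalar intro!: sum.cong)
    have "eval_free ?R a f = 0 \<longleftrightarrow> (\<forall>v. skew_op (eval_free ?R a f) v = 0)"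
      using skew_op_eq_0D[OF Kring_supported, of "eval_free ?R a f"] e(2) sub by auto
    then show ?thesis by (simp add: op)
  qed
  then show ?thesis by (auto simp: T_ideal_def)
qed

lemma mem_T_ideal_U:
  "f \<in> T_ideal (Kring\<lparr>carrier := U\<rparr>) \<longleftrightarrow>
    (\<forall>a\<in>UNIV \<rightarrow> U. \<forall>v. (\<Sum>w\<in>Poly_Mapping.keys f. to_fract (scale (Poly_Mapping.lookup f w) 1) *
       foldr (\<lambda>i. skew_op (a i)) w v) = 0)"
  by (rule mem_T_ideal_iff) (use U_Kring U_closed in auto)

lemma mem_T_ideal_Kring:
  "f \<in> T_ideal Kring \<longleftrightarrow>
    (\<forall>a\<in>UNIV \<rightarrow> carrier Kring. \<forall>v. (\<Sum>w\<in>Poly_Mapping.keys f. to_fract (scale (Poly_Mapping.lookup f w) 1) *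
       foldr (\<lambda>i. skew_op (a i)) w v) = 0)"
  using mem_T_ideal_iff[of "carrier Kring" f] Kring_closed U_Kring[OF U_closed(4)] by simp

section \<open>Finite \<open>M\<close>: a central localization\<close>

text \<open>Scalars invariant under both G and M commute with every operator of the fixed ring; they
  serve as central denominators.\<close>

definition Z :: "'a set" where
  "Z = {x \<in> \<Gamma>. \<forall>\<mu>\<in>M. \<mu> x = x}"

lemma skew_op_central:
  assumes "x \<in> carrier Kring" "t \<in> Z"
  shows "skew_op x (to_fract t * v) = to_fract t * skew_op x v"
  using assms M_embedding
  by (auto simp: skew_op_def Z_def mem_Kring_iff fract_map_simps sum_distrib_left subset_iff intro!: sum.cong)

lemma Z_closed: "s \<in> Z \<Longrightarrow> t \<in> Z \<Longrightarrow> s * t \<in> Z" "1 \<in> Z" "t \<in> Z \<Longrightarrow> t \<in> \<Gamma>"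
  by (auto simp: Z_def fixed_subring_closed ring_embedding_simps[OF M_embedding])

lemma Z_scale:
  assumes "t \<in> Z"
  shows "scale c t \<in> Z"
proof -
  have "\<mu> (scale c t) = scale c t" if \<mu>: "\<mu> \<in> M" for \<mu>
  proof -
    have "\<mu> (scale c t) = scale c (\<mu> t)" using M_Aut[OF \<mu>] by (simp add: mem_Aut_iff)
    then show ?thesis using assms \<mu> by (simp add: Z_def)
  qed
  then show ?thesis using assms fixed_subring_closed by (simp add: Z_def)
qed

text \<open>Both invariances hold because the factors are permuted: by conjugation for G, as b is
  fixed by G, and by left translation for M, which is injective and hence bijective on the finite
  set M.\<close>

lemma norm_in_Z:
  assumes "finite M" "b \<in> \<Gamma>"
  shows "(\<Prod>\<mu>\<in>M. \<mu> b) \<in> Z"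
proof -
  have "g (\<Prod>\<mu>\<in>M. \<mu> b) = (\<Prod>\<mu>\<in>M. \<mu> b)" if g: "g \<in> G" for g
  proof -
    have "inv_into UNIV g b = b"
      using G_inv[OF g] assms(2) by (auto simp: fixed_subring_def)
    then have "g (\<Prod>\<mu>\<in>M. \<mu> b) = (\<Prod>\<mu>\<in>M. (g \<circ> \<mu> \<circ> inv_into UNIV g) b)"
      by (simp add: ring_embedding_prod G_embedding[OF g])
    also have "\<dots> = (\<Prod>\<mu>\<in>M. \<mu> b)"
      by (rule prod.reindex_bij_betw[OF M_conj_bij[OF g], where g = "\<lambda>\<mu>. \<mu> b"])
    finally show ?thesis .
  qed
  moreover have "\<nu> (\<Prod>\<mu>\<in>M. \<mu> b) = (\<Prod>\<mu>\<in>M. \<mu> b)" if \<nu>: "\<nu> \<in> M" for \<nu>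
  proof -
    have inj: "inj_on (\<lambda>\<mu>. \<nu> \<circ> \<mu>) M"
      using ring_embedding_simps(6)[OF M_embedding[OF \<nu>]] by (auto simp: inj_on_def fun_eq_iff)
    have "(\<lambda>\<mu>. \<nu> \<circ> \<mu>) ` M = M"
      by (rule endo_inj_surj[OF assms(1) _ inj]) (use M_comp \<nu> in auto)
    then have "bij_betw (\<lambda>\<mu>. \<nu> \<circ> \<mu>) M M" using inj by (simp add: bij_betw_def)
    from prod.reindex_bij_betw[OF this, where g = "\<lambda>\<mu>. \<mu> b"]
    show ?thesis by (simp add: ring_embedding_prod M_embedding[OF \<nu>])
  qed
  ultimately show ?thesis by (simp add: Z_def fixed_subring_def)
qed

text \<open>With N the norm and b' its cofactor, a/b = ab'/N moves any fraction over a central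
  denominator. The cofactor is invariant because N and b are and b can be cancelled.\<close>

lemma norm_cofactor:
  assumes "finite M" "b \<in> \<Gamma>" "b \<noteq> 0"
  shows "(\<Prod>\<mu>\<in>M - {id}. \<mu> b) \<in> \<Gamma>" "(\<Prod>\<mu>\<in>M. \<mu> b) = b * (\<Prod>\<mu>\<in>M - {id}. \<mu> b)" "(\<Prod>\<mu>\<in>M. \<mu> b) \<noteq> 0"
proof -
  show eq: "(\<Prod>\<mu>\<in>M. \<mu> b) = b * (\<Prod>\<mu>\<in>M - {id}. \<mu> b)"
    using assms(1) M_id by (simp add: prod.remove)
  show "(\<Prod>\<mu>\<in>M. \<mu> b) \<noteq> 0"
    using assms by (simp add: prod_zero_iff ring_embedding_simps[OF M_embedding])
  have "g (\<Prod>\<mu>\<in>M - {id}. \<mu> b) = (\<Prod>\<mu>\<in>M - {id}. \<mu> b)" if g: "g \<in> G" for g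
  proof -
    have "g (b * (\<Prod>\<mu>\<in>M - {id}. \<mu> b)) = b * (\<Prod>\<mu>\<in>M - {id}. \<mu> b)" "g b = b"
      using norm_in_Z[OF assms(1,2)] assms(2) g unfolding eq by (auto simp: Z_def fixed_subring_def)
    then show ?thesis using assms(3) by (simp add: ring_embedding_simps[OF G_embedding[OF g]])
  qed
  then show "(\<Prod>\<mu>\<in>M - {id}. \<mu> b) \<in> \<Gamma>" by (simp add: fixed_subring_def)
qed

definition scalar_mult :: "'a \<Rightarrow> 'a skew \<Rightarrow> 'a skew" where
  "scalar_mult t y = skew_mult (Poly_Mapping.single id (to_fract t)) y"

lemma scalar_mult_Kring:
  assumes "t \<in> \<Gamma>" "y \<in> carrier Kring"
  shows "scalar_mult t y \<in> carrier Kring" "skew_op (scalar_mult t y) v = to_fract t * skew_op y v"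
  using assms by (simp_all add: scalar_mult_def Kring_closed(3) Kring_scalar Kring_mult_op op_scalar)

lemma scalar_mult_U: "t \<in> \<Gamma> \<Longrightarrow> y \<in> U \<Longrightarrow> scalar_mult t y \<in> U"
  unfolding scalar_mult_def by (intro U_closed U_scalar)

lemma scalar_mult_assoc:
  assumes "s \<in> \<Gamma>" "t \<in> \<Gamma>" "y \<in> carrier Kring"
  shows "scalar_mult (s * t) y = scalar_mult s (scalar_mult t y)"
  by (rule Kring_eqI)
    (use assms in \<open>simp_all add: scalar_mult_Kring fixed_subring_closed mult.assoc\<close>)

text \<open>For a product (a/b)u the norm of b clears the denominator; for a sum the product of the
  two denominators does.\<close>

lemma common_denominator:
  assumes "finite M" "y \<in> carrier Kring"
  shows "\<exists>z\<in>Z. z \<noteq> 0 \<and> scalar_mult z y \<in> U"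
  using assms(2)
proof (induction rule: Kring_induct)
  case zero
  have 0: "0 \<in> carrier Kring" using Kring_closed(4) assms(2) by blast
  have "scalar_mult 1 0 = 0"
    by (rule Kring_eqI) (simp_all add: scalar_mult_Kring fixed_subring_closed 0 del: to_fract_1)
  then show ?case using Z_closed U_closed by (intro bexI[of _ 1]) auto
next
  case (incl a b u)
  let ?b' = "\<Prod>\<mu>\<in>M - {id}. \<mu> b" and ?z = "\<Prod>\<mu>\<in>M. \<mu> b"
  let ?q = "Poly_Mapping.single id (Fraction_Field.Fract a b)"
  note b = norm_cofactor[OF assms(1) incl(2,3)]
  have "fract_map g (Fraction_Field.Fract a b) = Fraction_Field.Fract a b" if g: "g \<in> G" for g
  proof -
    have "g a = a" "g b = b" using incl(1,2) g by (auto simp: fixed_subring_def)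
    then show ?thesis using incl(3) by (simp add: fract_map_Fract'[OF G_embedding[OF g]])
  qed
  then have q: "?q \<in> carrier Kring"
    by (auto simp: mem_Kring_iff M_id op_scalar fract_map_simps(3)[OF G_embedding])
  have qu: "skew_mult ?q u \<in> carrier Kring" using q U_Kring[OF incl(4)] by (intro Kring_closed)
  have "scalar_mult ?z (skew_mult ?q u) = scalar_mult (a * ?b') u"
  proof (rule Kring_eqI)
    fix v
    have "to_fract ?z * Fraction_Field.Fract a b = to_fract (a * ?b')"
      unfolding b(2) using incl(3) by (simp add: Fract_conv_to_fract)
    then show "skew_op (scalar_mult ?z (skew_mult ?q u)) v = skew_op (scalar_mult (a * ?b') u) v"
      using qu q U_Kring[OF incl(4)] b(1) incl(1) Z_closed(3)[OF norm_in_Z[OF assms(1) incl(2)]]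
      by (simp add: scalar_mult_Kring fixed_subring_closed Kring_mult_op op_scalar mult.assoc[symmetric] del: to_fract_mult)
  qed (use qu U_Kring[OF incl(4)] b(1) incl(1) Z_closed(3)[OF norm_in_Z[OF assms(1) incl(2)]]
      in \<open>simp_all add: scalar_mult_Kring fixed_subring_closed\<close>)
  moreover have "scalar_mult (a * ?b') u \<in> U"
    using incl b(1) by (intro scalar_mult_U fixed_subring_closed)
  ultimately show ?case using b(3) norm_in_Z[OF assms(1) incl(2)] by metis
next
  case (minus y)
  then obtain z where z: "z \<in> Z" "z \<noteq> 0" "scalar_mult z y \<in> U" by blast
  have "scalar_mult z (- y) = scalar_mult (- 1) (scalar_mult z y)"
    by (rule Kring_eqI)
      (use z minus in \<open>simp_all add: scalar_mult_Kring fixed_subring_closed Z_closed Kring_closed(2)[of y y] skew_op_uminus\<close>)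
  moreover have "scalar_mult (- 1) (scalar_mult z y) \<in> U"
    using z(3) by (rule scalar_mult_U[rotated]) (intro fixed_subring_closed)
  ultimately show ?case using z by metis
next
  case (add x y)
  then obtain z t where z: "z \<in> Z" "z \<noteq> 0" "scalar_mult z x \<in> U"
    and t: "t \<in> Z" "t \<noteq> 0" "scalar_mult t y \<in> U" by blast
  have "scalar_mult (z * t) (x + y) = scalar_mult t (scalar_mult z x) + scalar_mult z (scalar_mult t y)"
    by (rule Kring_eqI)
      (use z t add in \<open>simp_all add: scalar_mult_Kring fixed_subring_closed Z_closed Kring_closed(1) skew_op_add algebra_simps\<close>)
  moreover have "scalar_mult t (scalar_mult z x) + scalar_mult z (scalar_mult t y) \<in> U"
    using z t by (simp add: U_closed(1) scalar_mult_U Z_closed(3))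
  ultimately show ?case using z t Z_closed by (intro bexI[of _ "z * t"]) auto
qed

lemma common_denominator_family:
  assumes "finite M" "finite I" "(a :: nat \<Rightarrow> _) \<in> UNIV \<rightarrow> carrier Kring"
  shows "\<exists>z\<in>Z. z \<noteq> 0 \<and> (\<forall>i\<in>I. scalar_mult z (a i) \<in> U)"
  using assms(2)
proof induction
  case empty
  then show ?case using Z_closed by (intro bexI[of _ 1]) auto
next
  case (insert j I)
  have a: "a i \<in> carrier Kring" for i using assms(3) by auto
  obtain z where z: "z \<in> Z" "z \<noteq> 0" "\<forall>i\<in>I. scalar_mult z (a i) \<in> U" using insert by blast
  obtain t where t: "t \<in> Z" "t \<noteq> 0" "scalar_mult t (a j) \<in> U"
    using common_denominator[OF assms(1) a] by blast
  have "scalar_mult (t * z) (a i) = scalar_mult t (scalar_mult z (a i))"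
    "scalar_mult (z * t) (a i) = scalar_mult z (scalar_mult t (a i))" for i
    using z t a by (auto intro: scalar_mult_assoc Z_closed)
  moreover have "scalar_mult t (scalar_mult z (a i)) \<in> U" if "i \<in> I" for i
    using z t that scalar_mult_U Z_closed(3) by blast
  moreover have "scalar_mult z (scalar_mult t (a j)) \<in> U"
    using z t scalar_mult_U Z_closed(3) by blast
  ultimately have "\<forall>i\<in>insert j I. scalar_mult (z * t) (a i) \<in> U" by (metis insert_iff mult.commute)
  then show ?case using z t Z_closed by (intro bexI[of _ "z * t"]) auto
qed

text \<open>
  For central \<open>t\<close>, evaluating \<open>f\<close> at \<open>t a\<close> gives a polynomial in \<open>t\<close>; it vanishes at the infinitely
  many \<open>t \<in> \<k> z\<close>, where \<open>z\<close> is a common denominator, hence at \<open>t = 1\<close>.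
\<close>

lemma T_ideal_le_finite:
  assumes "finite M"
  shows "T_ideal (Kring\<lparr>carrier := U\<rparr>) \<subseteq> T_ideal Kring"
proof
  fix f assume f: "f \<in> T_ideal (Kring\<lparr>carrier := U\<rparr>)"
  show "f \<in> T_ideal Kring"
    unfolding mem_T_ideal_Kring
  proof (intro ballI allI)
    fix a :: "nat \<Rightarrow> 'a skew" and v assume a: "a \<in> UNIV \<rightarrow> carrier Kring"
    define I where "I = (\<Union>w\<in>Poly_Mapping.keys f. set w)"
    have "finite I" by (simp add: I_def)
    then obtain z where z: "z \<in> Z" "z \<noteq> 0" "\<And>i. i \<in> I \<Longrightarrow> scalar_mult z (a i) \<in> U"
      using common_denominator_family[OF assms _ a] by blast
    define coef where "coef w = to_fract (scale (Poly_Mapping.lookup f w) 1)" for w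
    \<comment> \<open>Words of length d contribute to the coefficient of degree d, because a central
      factor t is pulled out once per letter.\<close>
    define P where "P = (\<Sum>w\<in>Poly_Mapping.keys f.
      Polynomial.monom (coef w * foldr (\<lambda>i. skew_op (a i)) w v) (length w))"
    have root: "poly P (to_fract (scale c z)) = 0" for c
    proof -
      define t where "t = scale c z"
      have t: "t \<in> Z" unfolding t_def by (rule Z_scale[OF z(1)])
      \<comment> \<open>Only the letters in \<open>I\<close> occur in f; the value 0 elsewhere keeps
        the whole assignment inside U.\<close>
      define a' where "a' i = (if i \<in> I then scalar_mult t (a i) else 0)" for i
      have "t = scale c 1 * z" by (simp add: t_def scale_mult[symmetric])
      then have "scalar_mult t (a i) = scalar_mult (scale c 1) (scalar_mult z (a i))" for i
        using a z by (auto intro: scalar_mult_assoc fixed_subring_closed Z_closed)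
      then have a': "a' \<in> UNIV \<rightarrow> U"
        using z(3) by (auto simp: a'_def U_closed scalar_mult_U fixed_subring_closed)
      have "foldr (\<lambda>i. skew_op (a' i)) w v = to_fract t ^ length w * foldr (\<lambda>i. skew_op (a i)) w v"
        if "set w \<subseteq> I" for w
        using that
      proof (induction w)
        case (Cons i w)
        have pow: "to_fract t ^ n = to_fract (t ^ n)" for n by (induction n) auto
        have tn: "t ^ n \<in> Z" for n by (induction n) (auto simp: Z_closed t)
        have ai: "a i \<in> carrier Kring" using a by auto
        show ?case using Cons ai t
          by (simp add: a'_def scalar_mult_Kring Z_closed(3) skew_op_central[OF ai tn] pow)
      qed simp
      then have "foldr (\<lambda>i. skew_op (a' i)) w v = to_fract t ^ length w * foldr (\<lambda>i. skew_op (a i)) w v"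
        if "w \<in> Poly_Mapping.keys f" for w
        using that by (auto simp: I_def)
      then have "poly P (to_fract t) = (\<Sum>w\<in>Poly_Mapping.keys f. coef w * foldr (\<lambda>i. skew_op (a' i)) w v)"
        unfolding P_def poly_sum poly_monom by (intro sum.cong) (auto simp: mult_ac)
      then show ?thesis using f a' unfolding mem_T_ideal_U coef_def t_def by auto
    qed
    have "inj (\<lambda>c. to_fract (scale c z))" using z(2) by (auto simp: inj_def)
    then have "infinite (range (\<lambda>c. to_fract (scale c z)))"
      using infinite_scalars finite_imageD by blast
    moreover have "range (\<lambda>c. to_fract (scale c z)) \<subseteq> {x. poly P x = 0}" using root by auto
    ultimately have "P = 0" using poly_roots_finite[of P] finite_subset by blast
    then have "poly P 1 = 0" by simp
    then show "(\<Sum>w\<in>Poly_Mapping.keys f. to_fract (scale (Poly_Mapping.lookup f w) 1) *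
       foldr (\<lambda>i. skew_op (a i)) w v) = 0"
      by (simp add: P_def poly_sum poly_monom coef_def)
  qed
qed

end

section \<open>Infinite \<open>M\<close>: no identities\<close>

text \<open>Step i of the walk contributes its \<gamma> evaluated under the product of the maps
  before it, and its \<delta> evaluated under the product up to and including its own map: the two
  endpoints of the step.\<close>

fun path_char :: "(nat \<Rightarrow> 'a::idom) \<Rightarrow> (nat \<Rightarrow> 'a) \<Rightarrow> (nat \<times> ('a \<Rightarrow> 'a)) list \<Rightarrow> 'a" where
  "path_char \<gamma> \<delta> [] = 1"
| "path_char \<gamma> \<delta> ((j, \<mu>) # p) = \<gamma> j * \<mu> (\<delta> j * path_char \<gamma> \<delta> p)"

lemma path_char_mult:
  assumes "\<forall>\<mu>\<in>snd ` set p. ring_embedding \<mu>"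
  shows "path_char (\<lambda>j. \<gamma> j * \<gamma>' j) (\<lambda>j. \<delta> j * \<delta>' j) p = path_char \<gamma> \<delta> p * path_char \<gamma>' \<delta>' p"
  using assms by (induction p) (auto simp: ring_embedding_simps mult_ac)

lemma path_char_cong:
  assumes "\<And>j. j \<in> fst ` set p \<Longrightarrow> \<gamma> j = \<gamma>' j \<and> \<delta> j = \<delta>' j"
  shows "path_char \<gamma> \<delta> p = path_char \<gamma>' \<delta>' p"
  using assms by (induction p) auto

lemma path_char_fun_upd:
  assumes "k \<notin> fst ` set p"
  shows "path_char (\<gamma>(k := x)) (\<delta>(k := y)) p = path_char \<gamma> \<delta> p"
  using assms by (intro path_char_cong) auto

lemma path_char_1:
  assumes "\<forall>\<mu>\<in>snd ` set p. ring_embedding \<mu>" "\<And>j. j \<in> fst ` set p \<Longrightarrow> \<gamma> j = 1 \<and> \<delta> j = 1"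
  shows "path_char \<gamma> \<delta> p = 1"
  using assms by (induction p) (auto simp: ring_embedding_simps)

lemma path_char_upd:
  assumes "\<forall>\<mu>\<in>snd ` set p. ring_embedding \<mu>" "k \<notin> fst ` set p"
  shows "path_char ((\<lambda>_. 1)(k := x)) (\<lambda>_. 1) p = 1" "path_char (\<lambda>_. 1) ((\<lambda>_. 1)(k := x)) p = 1"
  using assms by (intro path_char_1; auto)+

lemma upt_zip_notin: "k \<notin> fst ` set (zip [Suc k..<m] ms)"
  by (auto dest: set_zip_leftD)

abbreviation comps :: "('a \<Rightarrow> 'a) list \<Rightarrow> 'a \<Rightarrow> 'a" where
  "comps ms \<equiv> foldr (\<circ>) ms id"

lemma zip_upt_Cons: "zip [k..<k + length (\<nu> # ms)] (\<nu> # ms) = (k, \<nu>) # zip [Suc k..<Suc k + length ms] ms"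
  by (simp add: upt_conv_Cons del: upt_Suc)

text \<open>Placing x in the single slot \<gamma>\<open>\<^sub>j\<close> isolates the vertex from
  which the step labelled j starts. The offset \<open>k\<close> serves inductions that remove the
  first step.\<close>

lemma path_char_zip:
  assumes "\<forall>\<mu>\<in>set ms. ring_embedding \<mu>" "k \<le> j" "j < k + length ms"
  shows "path_char ((\<lambda>_. 1)(j := x)) (\<lambda>_. 1) (zip [k..<k + length ms] ms) = comps (take (j - k) ms) x"
  using assms
proof (induction ms arbitrary: k)
  case (Cons \<nu> ms)
  show ?case
  proof (cases "j = k")
    case True
    have "path_char ((\<lambda>_. 1)(k := x)) (\<lambda>_. 1) (zip [Suc k..<Suc k + length ms] ms) = 1"
      using Cons.prems(1) by (intro path_char_upd upt_zip_notin) (auto simp del: upt_Suc dest: set_zip_rightD)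
    then show ?thesis
      using True Cons.prems(1) unfolding zip_upt_Cons
      by (simp add: ring_embedding_simps fun_upd_same del: upt_Suc fun_upd_apply)
  next
    case False
    have "j - k = Suc (j - Suc k)" using False Cons.prems(2) by simp
    then show ?thesis
      using False Cons.prems Cons.IH[of "Suc k"] unfolding zip_upt_Cons by (simp del: upt_Suc)
  qed
qed simp

text \<open>Equivalently, the partial products are the distinct vertices of a path in the Cayley graph.\<close>

fun block_free :: "('a \<Rightarrow> 'a) list \<Rightarrow> bool" where
  "block_free [] \<longleftrightarrow> True"
| "block_free (\<mu> # ms) \<longleftrightarrow> (\<forall>k\<le>length ms. \<mu> \<circ> comps (take k ms) \<noteq> id) \<and> block_free ms"

section \<open>Walks determined by their characters\<close>

context galois_setting
begin

lemma comps_M: "set ms \<subseteq> M \<Longrightarrow> comps ms \<in> M"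
  by (induction ms) (auto simp: M_id M_comp)

text \<open>A new first map only has to avoid the inverses of finitely many prefix products. The
  empty prefix is among them and excludes the identity.\<close>

lemma block_free_exists:
  assumes "infinite M"
  shows "\<exists>ms. length ms = n \<and> set ms \<subseteq> M \<and> block_free ms"
proof (induction n)
  case (Suc n)
  then obtain ms where ms: "length ms = n" "set ms \<subseteq> M" "block_free ms" by blast
  define B where "B = (\<lambda>k. inv_into UNIV (comps (take k ms))) ` {..n}"
  have "finite B" by (simp add: B_def)
  then obtain \<mu> where \<mu>: "\<mu> \<in> M" "\<mu> \<notin> B"
    using assms by (meson finite_subset subsetI)
  have "\<mu> \<circ> comps (take k ms) \<noteq> id" if "k \<le> n" for k
  proof
    let ?c = "comps (take k ms)"
    assume eq: "\<mu> \<circ> ?c = id"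
    have "?c \<in> M" using ms(2) set_take_subset[of k ms] by (intro comps_M) blast
    then have "\<mu> = (\<mu> \<circ> ?c) \<circ> inv_into UNIV ?c"
      by (simp add: comp_assoc Aut_inv_simps[OF M_Aut])
    then have "\<mu> = inv_into UNIV ?c" by (simp add: eq)
    then show False using \<mu>(2) that by (auto simp: B_def)
  qed
  then show ?case using ms \<mu> by (intro exI[of _ "\<mu> # ms"]) auto
qed auto

text \<open>The walk is recovered step by step: the \<gamma> slots give the first label, the
  \<delta> slots the first map, and the rest follows by induction.\<close>

lemma path_unique:
  assumes "distinct (map fst p)" "snd ` set p \<subseteq> M" "fst ` set p = {k..<k + length ms}"
    and "set ms \<subseteq> M" "block_free ms"
    and "\<And>\<gamma> \<delta>. range \<gamma> \<subseteq> \<Gamma> \<Longrightarrow> range \<delta> \<subseteq> \<Gamma> \<Longrightarrow>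
      path_char \<gamma> \<delta> p = path_char \<gamma> \<delta> (zip [k..<k + length ms] ms)"
  shows "p = zip [k..<k + length ms] ms"
  using assms
proof (induction ms arbitrary: k p)
  case (Cons \<nu> ms)
  let ?q = "zip [Suc k..<Suc k + length ms] ms"
  obtain j \<mu> p' where p: "p = (j, \<mu>) # p'" using Cons.prems(3) by (cases p) auto
  have M: "\<mu> \<in> M" "\<nu> \<in> M" "snd ` set p' \<subseteq> M" "set ms \<subseteq> M"
    using Cons.prems p by auto
  have emb: "\<forall>\<mu>\<in>snd ` set p'. ring_embedding \<mu>" "\<forall>\<mu>\<in>set (\<nu> # ms). ring_embedding \<mu>"
    "\<forall>\<mu>\<in>snd ` set ?q. ring_embedding \<mu>" "ring_embedding \<mu>" "ring_embedding \<nu>"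
    using M M_embedding by (auto dest: set_zip_rightD)
  have jp': "j \<notin> fst ` set p'" using Cons.prems(1) p by auto
  have kq: "k \<notin> fst ` set ?q" by (rule upt_zip_notin)
  have j: "k \<le> j" "j < k + length (\<nu> # ms)" using Cons.prems(3) p by auto
  have eq: "path_char \<gamma> \<delta> ((j, \<mu>) # p') = path_char \<gamma> \<delta> ((k, \<nu>) # ?q)"
    if "range \<gamma> \<subseteq> \<Gamma>" "range \<delta> \<subseteq> \<Gamma>" for \<gamma> \<delta>
    using Cons.prems(6)[OF that] unfolding p zip_upt_Cons .
  have one: "range (\<lambda>_. 1) \<subseteq> \<Gamma>" and upd: "x \<in> \<Gamma> \<Longrightarrow> range ((\<lambda>_. 1)(i := x)) \<subseteq> \<Gamma>" for i :: nat and x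
    using fixed_subring_closed(3) by auto
  \<comment> \<open>Vary \<gamma> only at the first label j of p: the character of p is then x,
    while that of the reference walk is its vertex before step j, applied to x. That vertex must be
    the identity, which block-freeness allows only for j = k.\<close>
  have "comps (take (j - k) (\<nu> # ms)) = id"
  proof (rule separating)
    show "comps (take (j - k) (\<nu> # ms)) \<in> M"
      using Cons.prems(4) set_take_subset[of "j - k" "\<nu> # ms"] by (intro comps_M) blast
    fix x assume x: "x \<in> \<Gamma>"
    have "path_char ((\<lambda>_. 1)(j := x)) (\<lambda>_. 1) p' = 1"
      using emb(1) jp' by (rule path_char_upd)
    then have "x = path_char ((\<lambda>_. 1)(j := x)) (\<lambda>_. 1) ((j, \<mu>) # p')"
      using emb(4) by (simp add: ring_embedding_simps)
    also have "\<dots> = comps (take (j - k) (\<nu> # ms)) x"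
      unfolding eq[OF upd[OF x] one] using path_char_zip[OF emb(2) j] by (simp only: zip_upt_Cons)
    finally show "comps (take (j - k) (\<nu> # ms)) x = id x" by simp
  qed (rule M_id)
  moreover have "comps (take (j - k) (\<nu> # ms)) \<noteq> id" if "j \<noteq> k"
  proof -
    have "j - k = Suc (j - Suc k)" "j - Suc k \<le> length ms" using that j by auto
    then show ?thesis using Cons.prems(5) by simp
  qed
  ultimately have jk: "j = k" by blast
  have "\<mu> = \<nu>"
  proof (rule separating)
    fix x assume x: "x \<in> \<Gamma>"
    have "path_char (\<lambda>_. 1) ((\<lambda>_. 1)(k := x)) p' = 1" "path_char (\<lambda>_. 1) ((\<lambda>_. 1)(k := x)) ?q = 1"
      using path_char_upd(2)[OF emb(1)] path_char_upd(2)[OF emb(3) kq] jp' jk by auto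
    then show "\<mu> x = \<nu> x" using eq[OF one upd[OF x, of k]] jk by simp
  qed (use M in auto)
  have "p' = ?q"
  proof (rule Cons.IH)
    show "fst ` set p' = {Suc k..<Suc k + length ms}"
    proof -
      have "fst ` set p' = insert k (fst ` set p') - {k}" using jp' jk by auto
      also have "insert k (fst ` set p') = {k..<k + length (\<nu> # ms)}" using Cons.prems(3) p jk by auto
      finally show ?thesis by auto
    qed
    fix \<gamma> \<delta> :: "nat \<Rightarrow> 'a" assume \<gamma>\<delta>: "range \<gamma> \<subseteq> \<Gamma>" "range \<delta> \<subseteq> \<Gamma>"
    \<comment> \<open>Setting both slots at k to 1 strips the first step down to the common map
      \<nu>, which cancels by injectivity; the remaining walks do not contain the label k.\<close>
    let ?\<gamma> = "\<gamma>(k := 1)" and ?\<delta> = "\<delta>(k := 1)"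
    have "range ?\<gamma> \<subseteq> \<Gamma>" "range ?\<delta> \<subseteq> \<Gamma>" using \<gamma>\<delta> fixed_subring_closed(3) by auto
    from eq[OF this] have "\<nu> (path_char ?\<gamma> ?\<delta> p') = \<nu> (path_char ?\<gamma> ?\<delta> ?q)"
      using jk \<open>\<mu> = \<nu>\<close> by (simp del: upt_Suc)
    then have "path_char ?\<gamma> ?\<delta> p' = path_char ?\<gamma> ?\<delta> ?q"
      using emb(5) by (simp add: ring_embedding_simps)
    moreover have "path_char ?\<gamma> ?\<delta> p' = path_char \<gamma> \<delta> p'" "path_char ?\<gamma> ?\<delta> ?q = path_char \<gamma> \<delta> ?q"
      by (rule path_char_fun_upd[OF jp'[unfolded jk]], rule path_char_fun_upd[OF kq])
    ultimately show "path_char \<gamma> \<delta> p' = path_char \<gamma> \<delta> ?q" by simp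
  qed (use Cons.prems p M in auto)
  then show ?case using p jk \<open>\<mu> = \<nu>\<close> by (simp only: zip_upt_Cons)
qed auto

end

section \<open>Linearized identities expanded over walks\<close>

context galois_algebra_setting
begin

text \<open>The sum over the conjugation orbit of \<mu> lies in the fixed ring. Left multiplication
  by K does not enlarge supports, so KU being everything forces \<mu> into the support of some
  element of U.\<close>

lemma U_support:
  assumes "\<mu> \<in> M"
  shows "\<exists>u\<in>U. \<mu> \<in> Poly_Mapping.keys u"
proof -
  let ?conj = "\<lambda>g \<mu>. g \<circ> \<mu> \<circ> inv_into UNIV g"
  define orb where "orb = (\<lambda>g. ?conj g \<mu>) ` G"
  have fin: "finite orb" using G_finite by (simp add: orb_def)
  have orbM: "orb \<subseteq> M" using assms M_conj' by (auto simp: orb_def)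
  have "inv_into UNIV id = (id :: 'a \<Rightarrow> 'a)" by simp
  then have \<mu>orb: "\<mu> \<in> orb" unfolding orb_def using G_id by (intro image_eqI[of _ _ id]) auto
  define x where "x = (\<Sum>\<nu>\<in>orb. Poly_Mapping.single \<nu> (1 :: 'a fract))"
  have "Poly_Mapping.keys x \<subseteq> orb"
    unfolding x_def by (auto dest!: Poly_Mapping.keys_sum[THEN subsetD] split: if_splits)
  then have keys: "Poly_Mapping.keys x \<subseteq> M" using orbM by blast
  have op: "skew_op x v = (\<Sum>\<nu>\<in>orb. fract_map \<nu> v)" for v
    by (simp add: x_def skew_op_sum skew_op_single)
  have "skew_op x (fract_map g v) = fract_map g (skew_op x v)" if g: "g \<in> G" for g v
  proof -
    have inj: "inj_on (?conj g) orb"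
      using M_conj_bij[OF g] orbM by (auto simp: bij_betw_def intro: inj_on_subset)
    have "?conj g (?conj h \<mu>) = ?conj (g \<circ> h) \<mu>" if "h \<in> G" for h
      using G_Aut[OF g] G_Aut[OF that] by (simp add: o_inv_distrib mem_Aut_iff comp_assoc)
    then have "?conj g ` orb \<subseteq> orb" using G_comp[OF g] by (auto simp: orb_def)
    then have "?conj g ` orb = orb" by (rule endo_inj_surj[OF fin _ inj])
    then have bij: "bij_betw (?conj g) orb orb" using inj by (simp add: bij_betw_def)
    have "fract_map (?conj g \<nu>) (fract_map g v) = fract_map g (fract_map \<nu> v)" if "\<nu> \<in> orb" for \<nu>
    proof -
      have e: "ring_embedding g" "ring_embedding \<nu>" "ring_embedding (?conj g \<nu>)"
        using G_embedding[OF g] M_embedding M_conj'[OF g] orbM that by auto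
      have "?conj g \<nu> \<circ> g = g \<circ> \<nu>" by (simp add: comp_assoc Aut_inv_simps[OF G_Aut[OF g]])
      then show ?thesis using fract_map_comp[OF e(3,1)] fract_map_comp[OF e(1,2)] by metis
    qed
    then show ?thesis
      unfolding op sum.reindex_bij_betw[OF bij, symmetric, of "\<lambda>\<nu>. fract_map \<nu> (fract_map g v)"]
      by (simp add: fract_map_sum G_embedding[OF g])
  qed
  then have "x \<in> carrier Kring" using keys by (simp add: mem_Kring_iff)
  then have "Poly_Mapping.keys x \<subseteq> (\<Union>u\<in>U. Poly_Mapping.keys u)"
  proof (induction rule: Kring_induct)
    case (incl a b u)
    have "Poly_Mapping.keys (skew_mult (Poly_Mapping.single id (Fraction_Field.Fract a b)) u) \<subseteq> Poly_Mapping.keys u"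
      by (rule order_trans[OF keys_skew_mult]) (auto split: if_splits)
    then show ?case using incl by blast
  next
    case (add x y)
    then show ?case using Poly_Mapping.keys_add[of x y] by blast
  qed auto
  moreover have "Poly_Mapping.lookup x \<mu> = 1"
    using \<mu>orb fin by (simp add: x_def lookup_sum lookup_single when_def)
  then have "\<mu> \<in> Poly_Mapping.keys x" by (simp add: in_keys_iff)
  ultimately show ?thesis by blast
qed

lemma U_supported: "u \<in> U \<Longrightarrow> embedding_supported u"
  by (rule Kring_supported[OF U_Kring])

text \<open>Each variable is replaced by the sum of the new variables at its positions in w; by
  additivity a word expands into the index sequences that spell it.\<close>

lemma foldr_skew_op_sum:
  assumes y: "\<And>j. y j \<in> U" and a: "\<And>i. a i = (\<Sum>j | j < n \<and> w ! j = i. y j)"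
  shows "foldr (\<lambda>i. skew_op (a i)) w' v =
    (\<Sum>J | set J \<subseteq> {..<n} \<and> map ((!) w) J = w'. foldr (\<lambda>j. skew_op (y j)) J v)"
proof (induction w')
  case Nil
  have "{J. set J \<subseteq> {..<n} \<and> map ((!) w) J = []} = {[]}" by auto
  then show ?case by simp
next
  case (Cons i w')
  let ?S = "{J. set J \<subseteq> {..<n} \<and> map ((!) w) J = w'}" and ?A = "{j. j < n \<and> w ! j = i}"
  have S: "{J. set J \<subseteq> {..<n} \<and> map ((!) w) J = i # w'} = (\<lambda>(j, J). j # J) ` (?A \<times> ?S)"
    by (auto simp: map_eq_Cons_conv image_iff)
  have "foldr (\<lambda>i. skew_op (a i)) (i # w') v =
      (\<Sum>j\<in>?A. \<Sum>J\<in>?S. skew_op (y j) (foldr (\<lambda>j. skew_op (y j)) J v))"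
    using Cons by (simp add: a[of i] skew_op_sum skew_op_arg(3)[OF U_supported[OF y]])
  also have "\<dots> = (\<Sum>J | set J \<subseteq> {..<n} \<and> map ((!) w) J = i # w'. foldr (\<lambda>j. skew_op (y j)) J v)"
    unfolding S by (subst sum.reindex) (auto simp: inj_on_def sum.cartesian_product case_prod_unfold)
  finally show ?case .
qed

text \<open>Full linearization: only the terms in which every one of the \<open>n\<close> new variables occurs survive
  the successive substitutions \<open>y\<^sub>k = 0\<close>.\<close>

lemma linearize:
  assumes f: "f \<in> T_ideal (Kring\<lparr>carrier := U\<rparr>)"
    and len: "\<And>w'. w' \<in> Poly_Mapping.keys f \<Longrightarrow> length w' \<le> n"
    and y: "\<And>j. y j \<in> U" and "k \<le> n"
  shows "(\<Sum>J | set J \<subseteq> {..<n} \<and> map ((!) w) J \<in> Poly_Mapping.keys f \<and> {..<k} \<subseteq> set J.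
      to_fract (scale (Poly_Mapping.lookup f (map ((!) w) J)) 1) * foldr (\<lambda>j. skew_op (y j)) J v) = 0"
  using y \<open>k \<le> n\<close>
proof (induction k arbitrary: y)
  case 0
  let ?X = "{J. set J \<subseteq> {..<n} \<and> map ((!) w) J \<in> Poly_Mapping.keys f}"
  let ?c = "\<lambda>w'. to_fract (scale (Poly_Mapping.lookup f w') 1)"
  define a where "a i = (\<Sum>j | j < n \<and> w ! j = i. y j)" for i
  have "finite ?X"
  proof (rule finite_subset)
    show "?X \<subseteq> {J. set J \<subseteq> {..<n} \<and> length J \<le> n}" using len by (fastforce dest: len)
  qed (simp add: finite_lists_length_le)
  \<comment> \<open>The index sequences are grouped by the word that they spell; each group is the
    expansion of one monomial of f.\<close>
  then have "(\<Sum>J\<in>?X. ?c (map ((!) w) J) * foldr (\<lambda>j. skew_op (y j)) J v) =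
    (\<Sum>w'\<in>Poly_Mapping.keys f. \<Sum>J | J \<in> ?X \<and> map ((!) w) J = w'. ?c (map ((!) w) J) * foldr (\<lambda>j. skew_op (y j)) J v)"
    by (intro sum.group[symmetric]) auto
  also have "\<dots> = (\<Sum>w'\<in>Poly_Mapping.keys f. ?c w' * foldr (\<lambda>i. skew_op (a i)) w' v)"
  proof (rule sum.cong[OF refl])
    fix w' assume "w' \<in> Poly_Mapping.keys f"
    then have "{J. J \<in> ?X \<and> map ((!) w) J = w'} = {J. set J \<subseteq> {..<n} \<and> map ((!) w) J = w'}" by auto
    then show "(\<Sum>J | J \<in> ?X \<and> map ((!) w) J = w'. ?c (map ((!) w) J) * foldr (\<lambda>j. skew_op (y j)) J v)
        = ?c w' * foldr (\<lambda>i. skew_op (a i)) w' v"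
      using foldr_skew_op_sum[of y a n w w' v] 0(1) a_def by (simp add: sum_distrib_left)
  qed
  also have "\<dots> = 0"
  proof -
    have "a i \<in> U" for i unfolding a_def by (rule U_sum) (rule 0(1))
    then have "a \<in> UNIV \<rightarrow> U" by blast
    then show ?thesis using f mem_T_ideal_U by blast
  qed
  finally show ?case by simp
next
  case (Suc k)
  let ?X = "\<lambda>k. {J. set J \<subseteq> {..<n} \<and> map ((!) w) J \<in> Poly_Mapping.keys f \<and> {..<k} \<subseteq> set J}"
  let ?c = "\<lambda>w'. to_fract (scale (Poly_Mapping.lookup f w') 1)"
  have fin: "finite (?X k)"
  proof (rule finite_subset)
    show "?X k \<subseteq> {J. set J \<subseteq> {..<n} \<and> length J \<le> n}" by (fastforce dest: len)
  qed (simp add: finite_lists_length_le)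
  have foldr0: "foldr (\<lambda>j. skew_op ((y(k := 0)) j)) J v = (if k \<in> set J then 0 else foldr (\<lambda>j. skew_op (y j)) J v)" for J
    by (induction J) (auto simp: skew_op_arg(1)[OF U_supported[OF Suc.prems(1)]])
  \<comment> \<open>Subtracting the relation with y\<open>\<^sub>k\<close> = 0 cancels exactly the
    sequences that avoid k.\<close>
  have "0 = (\<Sum>J\<in>?X k. ?c (map ((!) w) J) * foldr (\<lambda>j. skew_op (y j)) J v)
    - (\<Sum>J\<in>?X k. ?c (map ((!) w) J) * foldr (\<lambda>j. skew_op ((y(k := 0)) j)) J v)"
    using Suc.IH[of y] Suc.IH[of "y(k := 0)"] Suc.prems U_closed(3) by simp
  also have "\<dots> = (\<Sum>J\<in>?X k. if k \<in> set J then ?c (map ((!) w) J) * foldr (\<lambda>j. skew_op (y j)) J v else 0)"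
    unfolding foldr0 sum_subtractf[symmetric] by (intro sum.cong) auto
  also have "\<dots> = (\<Sum>J\<in>?X (Suc k). ?c (map ((!) w) J) * foldr (\<lambda>j. skew_op (y j)) J v)"
    using fin by (simp add: sum.inter_filter[symmetric] lessThan_Suc)
      (intro sum.cong, auto)
  finally show ?case by simp
qed

text \<open>The part of a walk's contribution that depends on u alone; \<open>path_char\<close>
  carries the dependence on \<gamma> and \<delta>.\<close>

fun path_coef :: "(nat \<Rightarrow> 'a skew) \<Rightarrow> (nat \<times> ('a \<Rightarrow> 'a)) list \<Rightarrow> 'a fract" where
  "path_coef u [] = 1"
| "path_coef u ((j, \<mu>) # p) = Poly_Mapping.lookup (u j) \<mu> * fract_map \<mu> (path_coef u p)"

definition paths :: "(nat \<Rightarrow> 'a skew) \<Rightarrow> nat list \<Rightarrow> (nat \<times> ('a \<Rightarrow> 'a)) list set" where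
  "paths u J = {p. map fst p = J \<and> (\<forall>(j, \<mu>)\<in>set p. \<mu> \<in> Poly_Mapping.keys (u j))}"

lemma paths_Nil: "paths u [] = {[]}"
  by (auto simp: paths_def)

lemma paths_Cons: "paths u (j # J) = (\<lambda>(\<mu>, p). (j, \<mu>) # p) ` (Poly_Mapping.keys (u j) \<times> paths u J)"
  by (auto simp: paths_def map_eq_Cons_conv image_iff)

lemma finite_paths: "finite (paths u J)"
  by (induction J) (auto simp: paths_Nil paths_Cons)

lemma path_coef_nonzero:
  assumes "\<And>j. u j \<in> U" "p \<in> paths u J"
  shows "path_coef u p \<noteq> 0"
proof -
  have "\<forall>(j, \<mu>)\<in>set p. \<mu> \<in> Poly_Mapping.keys (u j)" using assms(2) by (simp add: paths_def)
  then show ?thesis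
  proof (induction p)
    case (Cons q p)
    obtain j \<mu> where q: "q = (j, \<mu>)" by force
    then have "ring_embedding \<mu>" using Cons.prems U_supported[OF assms(1)] by auto
    then show ?case using Cons q by (auto simp: fract_map_simps in_keys_iff)
  qed simp
qed

text \<open>The operators are applied to 1, each choosing one map from the support of its
  u\<open>\<^sub>j\<close>. Since L is commutative, the factors from u and those from \<gamma>,
  \<delta> can be collected separately.\<close>

lemma path_expansion:
  assumes u: "\<And>j. u j \<in> U" and \<gamma>: "range \<gamma> \<subseteq> \<Gamma>" and \<delta>: "range \<delta> \<subseteq> \<Gamma>"
    and y: "\<And>j. y j = scalar_mult (\<gamma> j) (skew_mult (u j) (Poly_Mapping.single id (to_fract (\<delta> j))))"
  shows "foldr (\<lambda>j. skew_op (y j)) J 1 = (\<Sum>p\<in>paths u J. path_coef u p * to_fract (path_char \<gamma> \<delta> p))"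
proof (induction J)
  case Nil
  then show ?case by (simp add: paths_Nil)
next
  case (Cons j J)
  have \<delta>j: "Poly_Mapping.single id (to_fract (\<delta> j)) \<in> carrier Kring" using \<delta> by (intro Kring_scalar) auto
  have y_op: "skew_op (y j) v = to_fract (\<gamma> j) * skew_op (u j) (to_fract (\<delta> j) * v)" for v
    using \<gamma> U_Kring[OF u] \<delta>j Kring_closed(3)[OF U_Kring[OF u] \<delta>j]
    by (subst y, subst scalar_mult_Kring) (auto simp: Kring_mult_op op_scalar)
  have emb: "ring_embedding \<mu>" if "\<mu> \<in> Poly_Mapping.keys (u j)" for \<mu>
    using U_supported[OF u] that by blast
  have "foldr (\<lambda>j. skew_op (y j)) (j # J) 1 =
     (\<Sum>\<mu>\<in>Poly_Mapping.keys (u j). \<Sum>p\<in>paths u J. path_coef u ((j, \<mu>) # p) * to_fract (path_char \<gamma> \<delta> ((j, \<mu>) # p)))"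
    by (auto simp: y_op Cons skew_op_def[of "u j"] sum_distrib_left emb fract_map_sum fract_map_simps
      ring_embedding_simps mult_ac intro!: sum.cong)
  also have "\<dots> = (\<Sum>p\<in>paths u (j # J). path_coef u p * to_fract (path_char \<gamma> \<delta> p))"
    unfolding paths_Cons by (subst sum.reindex) (auto simp: inj_on_def sum.cartesian_product case_prod_unfold)
  finally show ?case .
qed

lemma T_ideal_trivial_infinite:
  assumes "infinite M" and f: "f \<in> T_ideal (Kring\<lparr>carrier := U\<rparr>)"
  shows "f = 0"
proof (rule ccontr)
  assume "f \<noteq> 0"
  then have ne: "Poly_Mapping.keys f \<noteq> {}" by simp
  define n where "n = Max (length ` Poly_Mapping.keys f)"
  have "n \<in> length ` Poly_Mapping.keys f" unfolding n_def using ne by (intro Max_in) auto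
  \<comment> \<open>A word of maximal length: its coefficient is the one to be shown zero.\<close>
  then obtain w where w: "w \<in> Poly_Mapping.keys f" "length w = n" by auto
  have len: "length w' \<le> n" if "w' \<in> Poly_Mapping.keys f" for w'
    unfolding n_def using that by (intro Max_ge) auto
  obtain ms where ms: "length ms = n" "set ms \<subseteq> M" "block_free ms"
    using block_free_exists[OF assms(1)] by blast
  have "\<exists>u\<in>U. j < n \<longrightarrow> ms ! j \<in> Poly_Mapping.keys u" for j
    using U_support[of "ms ! j"] ms(1,2) U_closed(3) subsetD[OF ms(2) nth_mem, of j] by (cases "j < n") auto
  then obtain u where u: "\<And>j. u j \<in> U" "\<And>j. j < n \<Longrightarrow> ms ! j \<in> Poly_Mapping.keys (u j)"
    by metis
  define X where "X = {J. set J \<subseteq> {..<n} \<and> map ((!) w) J \<in> Poly_Mapping.keys f \<and> {..<n} \<subseteq> set J}"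
  define c where "c J = to_fract (scale (Poly_Mapping.lookup f (map ((!) w) J)) 1)" for J
  \<comment> \<open>All n indices occur in at most n places, so each J is a permutation.\<close>
  have XD: "set J = {..<n}" "distinct J" if "J \<in> X" for J
  proof -
    show "set J = {..<n}" using that by (auto simp: X_def)
    moreover have "length J \<le> n" using that len[of "map ((!) w) J"] by (auto simp: X_def)
    ultimately have "card (set J) = length J" using card_length[of J] by simp
    then show "distinct J" by (rule card_distinct)
  qed
  have finX: "finite X"
  proof (rule finite_subset)
    show "X \<subseteq> {J. set J \<subseteq> {..<n} \<and> length J \<le> n}" by (fastforce simp: X_def dest: len)
  qed (simp add: finite_lists_length_le)
  define T where "T = (\<Union>J\<in>X. paths u J)"
  have finT: "finite T" by (simp add: T_def finX finite_paths)
  have rel: "(\<Sum>p\<in>T. (c (map fst p) * path_coef u p) * to_fract (path_char \<gamma> \<delta> p)) = 0"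
    if \<gamma>: "range \<gamma> \<subseteq> \<Gamma>" and \<delta>: "range \<delta> \<subseteq> \<Gamma>" for \<gamma> \<delta>
  proof -
    define y where "y j = scalar_mult (\<gamma> j) (skew_mult (u j) (Poly_Mapping.single id (to_fract (\<delta> j))))" for j
    have "y j \<in> U" for j
      unfolding y_def using \<gamma> \<delta> u(1) by (intro scalar_mult_U U_closed U_scalar) auto
    then have "0 = (\<Sum>J\<in>X. c J * foldr (\<lambda>j. skew_op (y j)) J 1)"
      unfolding X_def c_def by (intro linearize[OF f len, symmetric]) auto
    also have "\<dots> = (\<Sum>J\<in>X. \<Sum>p\<in>paths u J. (c (map fst p) * path_coef u p) * to_fract (path_char \<gamma> \<delta> p))"
      unfolding path_expansion[OF u(1) \<gamma> \<delta> y_def]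
      by (auto simp: sum_distrib_left paths_def mult.assoc intro!: sum.cong)
    also have "\<dots> = (\<Sum>p\<in>T. (c (map fst p) * path_coef u p) * to_fract (path_char \<gamma> \<delta> p))"
      unfolding T_def using finX finite_paths
      by (intro sum.UNION_disjoint[symmetric]) (auto simp: paths_def)
    finally show ?thesis by simp
  qed
  \<comment> \<open>The reference walk takes the steps 0, ..., n-1 in order along the chosen maps
    \<open>ms\<close>.\<close>
  define p0 where "p0 = zip [0..<0 + length ms] ms"
  have p0: "map fst p0 = [0..<n]" "p0 \<in> paths u [0..<n]"
    using ms(1) u(2) by (auto simp: p0_def paths_def set_zip)
  have w_eq: "map ((!) w) [0..<n] = w" using w(2) map_nth by blast
  then have "[0..<n] \<in> X" using w(1) by (auto simp: X_def)
  then have "p0 \<in> T" using p0(2) by (auto simp: T_def)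
  have TM: "snd ` set p \<subseteq> M" if "p \<in> T" for p
    using that u(1) U_Kring mem_Kring_iff by (fastforce simp: T_def paths_def)
  \<comment> \<open>The characters live on pairs (\<gamma>, \<delta>) of \<Gamma>-valued families
    under pointwise multiplication; only the one of \<open>p0\<close> is known to differ from all
    others.\<close>
  have "c (map fst p0) * path_coef u p0 = 0"
  proof (rule dedekind_coefficient_zero[where k = p0 and I = T
        and S = "{(\<gamma>, \<delta>). range \<gamma> \<subseteq> \<Gamma> \<and> range \<delta> \<subseteq> \<Gamma>}"
        and m = "\<lambda>(\<gamma>, \<delta>) (\<gamma>', \<delta>'). (\<lambda>j. \<gamma> j * \<gamma>' j, \<lambda>j. \<delta> j * \<delta>' j)"
        and chi = "\<lambda>p (\<gamma>, \<delta>). to_fract (path_char \<gamma> \<delta> p)" and e = "(\<lambda>_. 1, \<lambda>_. 1)"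
        and c = "\<lambda>p. c (map fst p) * path_coef u p"])
    fix p assume p: "p \<in> T" "p \<noteq> p0"
    show "\<exists>s\<in>{(\<gamma>, \<delta>). range \<gamma> \<subseteq> \<Gamma> \<and> range \<delta> \<subseteq> \<Gamma>}.
      (case s of (\<gamma>, \<delta>) \<Rightarrow> to_fract (path_char \<gamma> \<delta> p)) \<noteq> (case s of (\<gamma>, \<delta>) \<Rightarrow> to_fract (path_char \<gamma> \<delta> p0))"
    proof (rule ccontr)
      assume "\<not> ?thesis"
      then have eq: "path_char \<gamma> \<delta> p = path_char \<gamma> \<delta> p0" if "range \<gamma> \<subseteq> \<Gamma>" "range \<delta> \<subseteq> \<Gamma>" for \<gamma> \<delta>
        using that by auto
      have "map fst p \<in> X" using p(1) by (auto simp: T_def paths_def)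
      then have "distinct (map fst p)" "fst ` set p = {0..<0 + length ms}"
        using XD[of "map fst p"] ms(1) by (auto simp: lessThan_atLeast0)
      then have "p = p0"
        unfolding p0_def using TM[OF p(1)] ms eq by (intro path_unique) (auto simp: p0_def)
      then show False using p(2) by simp
    qed
  next
    show "(case (\<lambda>_. 1, \<lambda>_. 1) of (\<gamma>, \<delta>) \<Rightarrow> to_fract (path_char \<gamma> \<delta> p0)) = 1"
    proof -
      have "path_char (\<lambda>_. 1) (\<lambda>_. 1) p0 = 1"
        using TM[OF \<open>p0 \<in> T\<close>] M_embedding by (intro path_char_1) auto
      then show ?thesis by simp
    qed
  next
    fix p s t assume "p \<in> T"
    then have "\<forall>\<mu>\<in>snd ` set p. ring_embedding \<mu>" using TM M_embedding by blast
    from path_char_mult[OF this]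
    show "(case (case s of (\<gamma>, \<delta>) \<Rightarrow> \<lambda>(\<gamma>', \<delta>'). (\<lambda>j. \<gamma> j * \<gamma>' j, \<lambda>j. \<delta> j * \<delta>' j)) t of
        (\<gamma>, \<delta>) \<Rightarrow> to_fract (path_char \<gamma> \<delta> p)) =
      (case s of (\<gamma>, \<delta>) \<Rightarrow> to_fract (path_char \<gamma> \<delta> p)) * (case t of (\<gamma>, \<delta>) \<Rightarrow> to_fract (path_char \<gamma> \<delta> p))"
      by (simp add: case_prod_unfold)
  qed (use finT \<open>p0 \<in> T\<close> rel fixed_subring_closed in \<open>auto simp: image_subset_iff\<close>)
  \<comment> \<open>The labels of \<open>p0\<close> spell w, so this scalar is the coefficient of w
    in f.\<close>
  moreover have "c (map fst p0) \<noteq> 0"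
    using w(1) by (simp add: c_def p0(1) w_eq in_keys_iff)
  ultimately show False using path_coef_nonzero[OF u(1) p0(2)] by simp
qed

section \<open>Comparison of the T-ideals\<close>

lemma T_ideal_eq: "T_ideal (Kring\<lparr>carrier := U\<rparr>) = T_ideal Kring"
proof
  show "T_ideal (Kring\<lparr>carrier := U\<rparr>) \<subseteq> T_ideal Kring"
  proof (cases "finite M")
    case False
    have "0 \<in> T_ideal Kring" by (simp add: mem_T_ideal_Kring)
    then show ?thesis using T_ideal_trivial_infinite[OF False] by blast
  qed (rule T_ideal_le_finite)
  show "T_ideal Kring \<subseteq> T_ideal (Kring\<lparr>carrier := U\<rparr>)"
    using U_Kring by (fastforce simp: mem_T_ideal_Kring mem_T_ideal_U)
qed

end

theorem theorem4p7:
  fixes scale :: "'k::field \<Rightarrow> 'a::idom \<Rightarrow> 'a"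
    and G M :: "('a \<Rightarrow> 'a) set"
    and U :: "'a skew set"
  assumes "galois_setting scale G M"
    and "infinite (UNIV :: 'k set)"
    and "galois_algebra scale G M U"
  shows "(PI_algebra ((skew_fixed_ring scale G M)\<lparr>carrier := U\<rparr>)
            \<longleftrightarrow> PI_algebra (skew_fixed_ring scale G M)) \<and>
         T_ideal ((skew_fixed_ring scale G M)\<lparr>carrier := U\<rparr>)
            = T_ideal (skew_fixed_ring scale G M)"
proof -
  have "T_ideal ((skew_fixed_ring scale G M)\<lparr>carrier := U\<rparr>) = T_ideal (skew_fixed_ring scale G M)"
    by (rule galois_algebra_setting.T_ideal_eq)
      (use assms in \<open>simp add: galois_algebra_setting_def galois_algebra_setting_axioms_def\<close>)
  \<comment> \<open>Being PI is a condition on the T-ideal alone.\<close>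
  then show ?thesis by (simp add: PI_algebra_def)
qed

end
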